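(* Let $G$ be a bipartite connected graph with $n \geq 4$ vertices and $m \geq n$ edges. Then $$Sz(G)-W(G) \geq 4n-8.$$ Equality holds if and only if $G$ is composed of a cycle $C_4$ on $4$ vertices and a tree $T$ on $n-3$ vertices sharing a single vertex.
   Context: All graphs are finite, undirected and simple. For a connected graph $G$, $d_G(u,v)$ is the distance between $u$ and $v$ in $G$, and the Wiener index is $W(G)=\sum_{\{u,v\}\subseteq V(G)} d_G(u,v)$ (sum over unordered pairs of distinct vertices). For an edge $e=uv$ let $n_u(e)=|\{w\in V(G): d_G(u,w)<d_G(v,w)\}|$ and $n_v(e)=|\{w\in V(G): d_G(v,w)<d_G(u,w)\}|$. The Szeged index is $Sz(G)=\sum_{e=uv\in E(G)} n_u(e)n_v(e)$. "A cycle and a tree sharing a single vertex" means that $G$ is the union of the cycle and the tree, which have exactly one vertex (and no edge) in common; the tree may be a single vertex. *)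

theory Defs
  imports Main
begin

text \<open>
  A finite simple graph is given by its vertex set \<open>V\<close> and its set \<open>E\<close> of edges, each edge
  being a two-element set of vertices.
\<close>

locale simple_graph =
  fixes V :: "'a set" and E :: "'a set set"
  assumes finite_V: "finite V"
    and edge_subset: "e \<in> E \<Longrightarrow> e \<subseteq> V"
    and edge_card: "e \<in> E \<Longrightarrow> card e = 2"

text \<open>A walk is the nonempty list of its vertices; it has \<open>length p - 1\<close> edges.\<close>

definition walk_betw :: "'a set \<Rightarrow> 'a set set \<Rightarrow> 'a \<Rightarrow> 'a list \<Rightarrow> 'a \<Rightarrow> bool" where
  "walk_betw V E u p v \<longleftrightarrow>
     p \<noteq> [] \<and> hd p = u \<and> last p = v \<and> set p \<subseteq> V \<and>
     (\<forall>i. Suc i < length p \<longrightarrow> {p ! i, p ! Suc i} \<in> E)"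

definition connected_graph :: "'a set \<Rightarrow> 'a set set \<Rightarrow> bool" where
  "connected_graph V E \<longleftrightarrow> V \<noteq> {} \<and> (\<forall>u\<in>V. \<forall>v\<in>V. \<exists>p. walk_betw V E u p v)"

definition bipartite_graph :: "'a set \<Rightarrow> 'a set set \<Rightarrow> bool" where
  "bipartite_graph V E \<longleftrightarrow>
     (\<exists>A B. A \<union> B = V \<and> A \<inter> B = {} \<and> (\<forall>e\<in>E. \<exists>a\<in>A. \<exists>b\<in>B. e = {a, b}))"

text \<open>Only meaningful for vertices \<open>u\<close> and \<open>v\<close> that are joined by a walk.\<close>

definition graph_dist :: "'a set \<Rightarrow> 'a set set \<Rightarrow> 'a \<Rightarrow> 'a \<Rightarrow> nat" where
  "graph_dist V E u v = (LEAST k. \<exists>p. walk_betw V E u p v \<and> length p = Suc k)"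

text \<open>The value \<open>f u v\<close> of a symmetric function \<open>f\<close> at the unordered pair \<open>{u, v}\<close>.\<close>

definition on_pair :: "('a \<Rightarrow> 'a \<Rightarrow> 'b) \<Rightarrow> 'a set \<Rightarrow> 'b" where
  "on_pair f P = (THE y. \<exists>u v. P = {u, v} \<and> y = f u v)"

lemma on_pair_eq:
  assumes "\<And>u v. f u v = f v u"
  shows "on_pair f {u, v} = f u v"
  unfolding on_pair_def
proof (rule the_equality)
  show "\<exists>u' v'. {u, v} = {u', v'} \<and> f u v = f u' v'"
    by blast
next
  fix y assume "\<exists>u' v'. {u, v} = {u', v'} \<and> y = f u' v'"
  then show "y = f u v"
    using assms by (auto simp: doubleton_eq_iff)
qed

definition wiener_index :: "'a set \<Rightarrow> 'a set set \<Rightarrow> nat" where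
  "wiener_index V E = (\<Sum>P \<in> {P. P \<subseteq> V \<and> card P = 2}. on_pair (graph_dist V E) P)"

definition closer_count :: "'a set \<Rightarrow> 'a set set \<Rightarrow> 'a \<Rightarrow> 'a \<Rightarrow> nat" where
  "closer_count V E u v = card {w \<in> V. graph_dist V E u w < graph_dist V E v w}"

definition szeged_index :: "'a set \<Rightarrow> 'a set set \<Rightarrow> nat" where
  "szeged_index V E =
     (\<Sum>e\<in>E. on_pair (\<lambda>u v. closer_count V E u v * closer_count V E v u) e)"

lemma walk_betw_rev:
  assumes "walk_betw V E u p v"
  shows "walk_betw V E v (rev p) u"
proof -
  have "{rev p ! i, rev p ! Suc i} \<in> E" if i: "Suc i < length p" for i
  proof -
    define j where "j = length p - Suc (Suc i)"
    have "Suc j < length p" "rev p ! i = p ! Suc j" "rev p ! Suc i = p ! j"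
      using i by (auto simp: j_def rev_nth Suc_diff_Suc)
    then show ?thesis
      using assms by (auto simp: walk_betw_def insert_commute)
  qed
  then show ?thesis
    using assms by (auto simp: walk_betw_def hd_rev last_rev)
qed

lemma graph_dist_commute: "graph_dist V E u v = graph_dist V E v u"
proof -
  have "(\<exists>p. walk_betw V E u p v \<and> length p = Suc k) \<longleftrightarrow>
        (\<exists>p. walk_betw V E v p u \<and> length p = Suc k)" for k
    by (metis walk_betw_rev length_rev)
  then show ?thesis
    by (simp add: graph_dist_def)
qed

lemma on_pair_graph_dist: "on_pair (graph_dist V E) {u, v} = graph_dist V E u v"
  by (rule on_pair_eq) (rule graph_dist_commute)

lemma on_pair_closer_count:
  "on_pair (\<lambda>u v. closer_count V E u v * closer_count V E v u) {u, v} =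
     closer_count V E u v * closer_count V E v u"
  by (rule on_pair_eq) (rule mult.commute)

definition cycle_graph :: "'a set \<Rightarrow> 'a set set \<Rightarrow> bool" where
  "cycle_graph V E \<longleftrightarrow>
     (\<exists>c. distinct c \<and> 3 \<le> length c \<and> V = set c \<and>
          E = {{c ! i, c ! (Suc i mod length c)} | i. i < length c})"

definition acyclic_graph :: "'a set \<Rightarrow> 'a set set \<Rightarrow> bool" where
  "acyclic_graph V E \<longleftrightarrow> \<not> (\<exists>V' E'. V' \<subseteq> V \<and> E' \<subseteq> E \<and> cycle_graph V' E')"

definition tree_graph :: "'a set \<Rightarrow> 'a set set \<Rightarrow> bool" where
  "tree_graph V E \<longleftrightarrow> simple_graph V E \<and> connected_graph V E \<and> acyclic_graph V E"

definition cycle_tree_sharing_vertex :: "nat \<Rightarrow> nat \<Rightarrow> 'a set \<Rightarrow> 'a set set \<Rightarrow> bool" where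
  "cycle_tree_sharing_vertex k l V E \<longleftrightarrow>
     (\<exists>V\<^sub>C E\<^sub>C V\<^sub>T E\<^sub>T.
        cycle_graph V\<^sub>C E\<^sub>C \<and> card V\<^sub>C = k \<and>
        tree_graph V\<^sub>T E\<^sub>T \<and> card V\<^sub>T = l \<and>
        V = V\<^sub>C \<union> V\<^sub>T \<and> E = E\<^sub>C \<union> E\<^sub>T \<and>
        (\<exists>x. V\<^sub>C \<inter> V\<^sub>T = {x}) \<and> E\<^sub>C \<inter> E\<^sub>T = {})"

end

theory Submission
  imports Defs
begin

text \<open>
  Let the excess of a pair \<open>x, y\<close> be the number of edges separating \<open>x\<close> from \<open>y\<close>, minus their
  distance. It is nonnegative, since the edges of a geodesic separate its ends, and its sum over
  all ordered pairs is \<open>2 (Sz - W)\<close>. A graph with \<open>m \<ge> n\<close> has a vertex with two neighbours closer to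
  some other vertex; a closest such configuration yields an isometric cycle of length \<open>2 k\<close>. For
  every vertex \<open>x\<close>, the excesses of \<open>x\<close> with two antipodal vertices of this cycle sum up to at
  least \<open>k\<close>, so the total excess is at least \<open>2 k\<^sup>2 (n - k) \<ge> 8 n - 16\<close>.

  In the case of equality, \<open>k = 2\<close> and every vertex outside the cycle reaches the cycle through a
  gate. Vertices with different gates would have positive excess, so the gate is common, and a
  cycle elsewhere would produce a vertex of positive excess with the gate.
\<close>

section \<open>Distances in connected bipartite graphs\<close>

text \<open>Bipartiteness makes every vertex strictly closer to one end of each edge, so distances
  move by exactly one per step along a cycle; all counting rests on this. The constant arises by
  splitting \<open>V \<times> V\<close> along the vertex set \<open>C\<close> of the isometric
  cycle. Each of the \<open>n\<close> rows contributes at least \<open>k\<^sup>2\<close> over the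
  columns in \<open>C\<close>, which form \<open>k\<close> antipodal pairs. By symmetry the
  \<open>n - 2 k\<close> rows outside \<open>C\<close> contribute once more, and the remaining block
  is merely nonnegative. The bound \<open>2 k\<^sup>2 (n - k)\<close> exceeds
  \<open>8 n - 16\<close> by a positive multiple of \<open>k - 2\<close>, so equality singles out
  cycles of length 4. The converse needs no exact computation either: upper bounds for the excess in
  the glued graph suffice, as they meet the general lower bound.\<close>

lemma walk_betw_snoc:
  assumes p: "walk_betw V E u p v" and e: "{v, w} \<in> E" and w: "w \<in> V"
  shows "walk_betw V E u (p @ [w]) w"
  unfolding walk_betw_def
proof (intro conjI allI impI)
  fix i assume i: "Suc i < length (p @ [w])"
  show "{(p @ [w]) ! i, (p @ [w]) ! Suc i} \<in> E"
  proof (cases "Suc i < length p")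
    case True
    then show ?thesis using p by (auto simp: walk_betw_def nth_append)
  next
    case False
    then have "i = length p - 1" "p \<noteq> []" using i p by (auto simp: walk_betw_def)
    then show ?thesis using p e
      by (auto simp: walk_betw_def nth_append last_conv_nth)
  qed
qed (use p w in \<open>auto simp: walk_betw_def\<close>)

locale bip_graph = simple_graph +
  assumes connected: "connected_graph V E"
    and bipartite: "bipartite_graph V E"
begin

abbreviation d where "d \<equiv> graph_dist V E"

lemma finite_E: "finite E"
  by (rule finite_subset[of _ "Pow V"]) (use edge_subset finite_V in auto)

lemma edge_in_V: "{u, v} \<in> E \<Longrightarrow> u \<in> V \<and> v \<in> V"
  using edge_subset by blast

lemma edge_neq: "{u, v} \<in> E \<Longrightarrow> u \<noteq> v"
  using edge_card by fastforce

lemma edgeE: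
  assumes "e \<in> E"
  obtains u v where "e = {u, v}" "{u, v} \<in> E" "u \<noteq> v"
  using edge_card[OF assms] assms by (auto simp: card_2_iff)

lemma dist_walk:
  assumes "u \<in> V" "v \<in> V"
  obtains p where "walk_betw V E u p v" "length p = Suc (d u v)"
proof -
  obtain p where p: "walk_betw V E u p v"
    using assms connected by (auto simp: connected_graph_def)
  then have "length p = Suc (length p - 1)"
    by (cases p) (auto simp: walk_betw_def)
  with p have "\<exists>k p. walk_betw V E u p v \<and> length p = Suc k" by blast
  then have "\<exists>p. walk_betw V E u p v \<and> length p = Suc (d u v)"
    unfolding graph_dist_def by (rule LeastI_ex)
  then show thesis using that by blast
qed

lemma dist_le: "walk_betw V E u p v \<Longrightarrow> length p = Suc k \<Longrightarrow> d u v \<le> k"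
  unfolding graph_dist_def by (rule Least_le) blast

lemma dist_self: "u \<in> V \<Longrightarrow> d u u = 0"
  using dist_le[of u "[u]" u 0] by (simp add: walk_betw_def)

lemma dist_eq_0: "u \<in> V \<Longrightarrow> v \<in> V \<Longrightarrow> d u v = 0 \<longleftrightarrow> u = v"
proof
  assume "u \<in> V" "v \<in> V" "d u v = 0"
  then obtain p where "walk_betw V E u p v" "length p = Suc 0"
    using dist_walk by metis
  then show "u = v" by (cases p) (auto simp: walk_betw_def)
qed (simp add: dist_self)

lemma dist_edge_le:
  assumes "u \<in> V" "{v, w} \<in> E"
  shows "d u w \<le> Suc (d u v)"
proof -
  obtain p where p: "walk_betw V E u p v" "length p = Suc (d u v)"
    using dist_walk assms edge_in_V by metis
  have "walk_betw V E u (p @ [w]) w"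
    using walk_betw_snoc p(1) assms(2) edge_in_V by metis
  then show ?thesis using dist_le p by fastforce
qed

lemma dist_pred:
  assumes "u \<in> V" "v \<in> V" "u \<noteq> v"
  obtains w where "{w, v} \<in> E" "d u v = Suc (d u w)"
proof -
  obtain p where p: "walk_betw V E u p v" "length p = Suc (d u v)"
    using dist_walk assms by metis
  have d0: "d u v > 0" using assms dist_eq_0 by blast
  define q where "q = butlast p"
  define w where "w = last q"
  have q: "length q = d u v" "q \<noteq> []" using p d0 by (auto simp: q_def simp flip: length_greater_0_conv)
  have p_eq: "p = q @ [v]"
    using p by (auto simp: q_def walk_betw_def)
  have nth: "{p ! i, p ! Suc i} \<in> E" if "Suc i < length p" for i
    using p that by (auto simp: walk_betw_def)
  have e: "{w, v} \<in> E"
    using nth[of "length q - 1"] q d0 by (auto simp: p_eq nth_append w_def last_conv_nth)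
  have "{q ! i, q ! Suc i} \<in> E" if "Suc i < length q" for i
    using nth[of i] that by (auto simp: p_eq nth_append)
  then have "walk_betw V E u q w"
    using p q by (auto simp: walk_betw_def p_eq w_def)
  then have "d u w \<le> d u v - 1" using q d0 by (intro dist_le) auto
  moreover have "d u v \<le> Suc (d u w)" using dist_edge_le e assms by blast
  ultimately show thesis using that e d0 by simp
qed

lemma dist_triangle:
  assumes "u \<in> V" "v \<in> V" "w \<in> V"
  shows "d u w \<le> d u v + d v w"
  using assms(3)
proof (induction "d v w" arbitrary: w)
  case 0
  then show ?case using assms dist_eq_0 by simp
next
  case (Suc n)
  then have "v \<noteq> w" using dist_self assms by force
  then obtain x where x: "{x, w} \<in> E" "d v w = Suc (d v x)"
    using dist_pred assms Suc.prems by metis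
  then have "d u x \<le> d u v + d v x"
    using Suc edge_in_V by auto
  moreover have "d u w \<le> Suc (d u x)" using dist_edge_le x assms by blast
  ultimately show ?case using x by simp
qed

lemma dist_parity:
  obtains A where "\<And>u v. u \<in> V \<Longrightarrow> v \<in> V \<Longrightarrow> even (d u v) \<longleftrightarrow> (u \<in> A \<longleftrightarrow> v \<in> A)"
    "\<And>u v. {u, v} \<in> E \<Longrightarrow> u \<in> A \<longleftrightarrow> v \<notin> A"
proof -
  obtain A B where AB: "A \<inter> B = {}" "\<forall>e\<in>E. \<exists>a\<in>A. \<exists>b\<in>B. e = {a, b}"
    using bipartite by (auto simp: bipartite_graph_def)
  have col: "u \<in> A \<longleftrightarrow> v \<notin> A" if "{u, v} \<in> E" for u v
  proof -
    obtain a b where "a \<in> A" "b \<in> B" "{u, v} = {a, b}" using AB \<open>{u, v} \<in> E\<close> by metis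
    then show ?thesis using AB(1) by (auto simp: doubleton_eq_iff)
  qed
  have "even (d u v) \<longleftrightarrow> (u \<in> A \<longleftrightarrow> v \<in> A)" if "u \<in> V" "v \<in> V" for u v
    using that
  proof (induction "d u v" arbitrary: v)
    case 0
    then show ?case using dist_eq_0[of u v] dist_self[of v] by auto
  next
    case (Suc n)
    then have "u \<noteq> v" using dist_self by force
    then obtain w where w: "{w, v} \<in> E" "d u v = Suc (d u w)"
      using dist_pred Suc.prems by metis
    then have "even (d u w) \<longleftrightarrow> (u \<in> A \<longleftrightarrow> w \<in> A)"
      using Suc edge_in_V by auto
    then show ?case using w col by auto
  qed
  with col show thesis using that by blast
qed

text \<open>By parity, no edge has both ends at the same distance from \<open>u\<close>. This is the
  form in which bipartiteness is used in the counting arguments.\<close>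

lemma dist_edge:
  assumes "u \<in> V" "{v, w} \<in> E"
  shows "d u w = Suc (d u v) \<or> d u v = Suc (d u w)"
proof -
  have vw: "v \<in> V" "w \<in> V" using assms edge_in_V by auto
  have "d u w \<noteq> d u v"
    by (rule dist_parity) (metis assms vw)
  moreover have "d u w \<le> Suc (d u v)" "d u v \<le> Suc (d u w)"
    using dist_edge_le[of u v w] dist_edge_le[of u w v] assms
    by (auto simp: insert_commute)
  ultimately show ?thesis by linarith
qed

lemma dist_edge_1: "{v, w} \<in> E \<Longrightarrow> d v w = 1"
  using dist_edge[of v v w] dist_self edge_in_V by fastforce

text \<open>Descending along \<open>f\<close> bounds the distance by \<open>f\<close>, and following
  a geodesic bounds \<open>f\<close> by the distance. It serves to recognise the distance of the
  whole graph inside a subgraph.\<close>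

lemma dist_unique:
  assumes u: "u \<in> V" "f u = 0"
    and edge: "\<And>v w. {v, w} \<in> E \<Longrightarrow> f w \<le> Suc (f v)"
    and pred: "\<And>v. v \<in> V \<Longrightarrow> v \<noteq> u \<Longrightarrow> \<exists>w. {w, v} \<in> E \<and> f v = Suc (f w)"
    and v: "v \<in> V"
  shows "d u v = f v"
proof (rule antisym)
  show "d u v \<le> f v"
    using v
  proof (induction "f v" arbitrary: v rule: less_induct)
    case less
    show ?case
    proof (cases "v = u")
      case False
      then obtain w where w: "{w, v} \<in> E" "f v = Suc (f w)" using pred less.prems by blast
      then have "d u w \<le> f w" using less edge_in_V by auto
      then show ?thesis using dist_edge_le[OF u(1) w(1)] w by simp
    qed (simp add: dist_self u)
  qed
  show "f v \<le> d u v"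
    using v
  proof (induction "d u v" arbitrary: v rule: less_induct)
    case less
    show ?case
    proof (cases "v = u")
      case False
      then obtain w where w: "{w, v} \<in> E" "d u v = Suc (d u w)"
        using dist_pred less.prems u by metis
      then have "f w \<le> d u w" using less edge_in_V by auto
      then show ?thesis using edge[OF w(1)] w by simp
    qed (simp add: u)
  qed
qed

text \<open>The distance from the far end is recorded as well, so that each edge of the path is
  immediately seen to separate \<open>u\<close> from \<open>v\<close>.\<close>

definition geodesic :: "'a \<Rightarrow> (nat \<Rightarrow> 'a) \<Rightarrow> 'a \<Rightarrow> bool" where
  "geodesic u p v \<longleftrightarrow> p 0 = u \<and> p (d u v) = v \<and>
     (\<forall>i<d u v. {p i, p (Suc i)} \<in> E) \<and>
     (\<forall>i\<le>d u v. p i \<in> V \<and> d u (p i) = i \<and> d v (p i) = d u v - i)"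

lemma geodesic_exists:
  assumes "u \<in> V" "v \<in> V"
  obtains p where "geodesic u p v"
proof -
  have "\<exists>p. p 0 = u \<and> p (d u v) = v \<and> (\<forall>i<d u v. {p i, p (Suc i)} \<in> E) \<and>
     (\<forall>i\<le>d u v. p i \<in> V \<and> d u (p i) = i)"
    using assms(2)
  proof (induction "d u v" arbitrary: v)
    case 0
    then have "u = v" using assms dist_eq_0 by simp
    then show ?case using assms 0 by (intro exI[of _ "\<lambda>_. u"]) (auto simp: dist_self)
  next
    case (Suc n)
    then have "u \<noteq> v" using dist_self by force
    then obtain w where w: "{w, v} \<in> E" "d u v = Suc (d u w)"
      using dist_pred Suc.prems assms by metis
    then have "n = d u w" "w \<in> V" using Suc.hyps(2) edge_in_V by auto
    from Suc.hyps(1)[OF this] obtain p where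
      p: "p 0 = u" "p (d u w) = w" "\<forall>i<d u w. {p i, p (Suc i)} \<in> E"
        "\<forall>i\<le>d u w. p i \<in> V \<and> d u (p i) = i"
      by blast
    show ?case
      by (intro exI[of _ "p(Suc (d u w) := v)"])
        (use p w Suc.prems in \<open>auto simp: less_Suc_eq le_Suc_eq\<close>)
  qed
  then obtain p where p: "p 0 = u" "p (d u v) = v" "\<forall>i<d u v. {p i, p (Suc i)} \<in> E"
     "\<forall>i\<le>d u v. p i \<in> V \<and> d u (p i) = i"
    by blast
  have "d v (p (d u v - j)) \<le> j" if "j \<le> d u v" for j
    using that
  proof (induction j)
    case 0
    then show ?case using p(2) assms dist_self by simp
  next
    case (Suc j)
    then have "{p (d u v - Suc j), p (d u v - j)} \<in> E"
      using p(3)[rule_format, of "d u v - Suc j"] by (simp add: Suc_diff_Suc)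
    then have "d v (p (d u v - Suc j)) \<le> Suc (d v (p (d u v - j)))"
      using assms by (intro dist_edge_le) (auto simp: insert_commute)
    then show ?case using Suc by simp
  qed
  then have "d v (p i) \<le> d u v - i" if "i \<le> d u v" for i
    using that by (metis diff_diff_cancel diff_le_self)
  moreover have "d u v \<le> i + d v (p i)" if "i \<le> d u v" for i
    using dist_triangle[of u "p i" v] p that assms by (simp add: graph_dist_commute)
  ultimately have "d v (p i) = d u v - i" if "i \<le> d u v" for i
    using that by (metis diff_add_inverse diff_le_mono le_antisym)
  then show thesis using that p unfolding geodesic_def by blast
qed

section \<open>The excess of separating edges over the distance\<close>

text \<open>These are the edges through which the pair enters the Szeged index: with the ends named
  as here, \<open>x\<close> is counted by \<open>closer_count V E u v\<close> and \<open>y\<close>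
  by \<open>closer_count V E v u\<close>.\<close>

definition sep_edges :: "'a \<Rightarrow> 'a \<Rightarrow> 'a set set" where
  "sep_edges x y = {{u, v} | u v. {u, v} \<in> E \<and> d x u < d x v \<and> d y v < d y u}"

definition excess :: "'a \<Rightarrow> 'a \<Rightarrow> int" where
  "excess x y = int (card (sep_edges x y)) - int (d x y)"

lemma sep_edges_subset: "sep_edges x y \<subseteq> E"
  by (auto simp: sep_edges_def)

lemma finite_sep_edges: "finite (sep_edges x y)"
  using finite_E sep_edges_subset by (rule rev_finite_subset)

lemma sep_edgesI: "{u, v} \<in> E \<Longrightarrow> d x u < d x v \<Longrightarrow> d y v < d y u \<Longrightarrow> {u, v} \<in> sep_edges x y"
  by (auto simp: sep_edges_def)

lemma sep_edges_iff:
  "{u, v} \<in> sep_edges x y \<longleftrightarrow>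
     {u, v} \<in> E \<and> (d x u < d x v \<and> d y v < d y u \<or> d x v < d x u \<and> d y u < d y v)"
  using sep_edgesI[of u v x y] sep_edgesI[of v u x y]
  by (auto simp: sep_edges_def doubleton_eq_iff insert_commute)

lemma sep_edges_commute: "sep_edges x y = sep_edges y x"
proof -
  have "sep_edges x y \<subseteq> sep_edges y x" for x y
  proof
    fix e assume "e \<in> sep_edges x y"
    then obtain u v where "e = {v, u}" "{v, u} \<in> E" "d x u < d x v" "d y v < d y u"
      unfolding sep_edges_def by (auto simp: insert_commute)
    then show "e \<in> sep_edges y x" using sep_edgesI by blast
  qed
  then show ?thesis by blast
qed

lemma excess_commute: "excess x y = excess y x"
  by (simp add: excess_def sep_edges_commute[of x y] graph_dist_commute[of V E x y])

text \<open>The length is a parameter because the same notion describes initial pieces of geodesics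
  and, with \<open>m = 2 * k\<close>, the edge set of an isometric cycle.\<close>

definition path_edges :: "(nat \<Rightarrow> 'a) \<Rightarrow> nat \<Rightarrow> 'a set set" where
  "path_edges p m = (\<lambda>j. {p j, p (Suc j)}) ` {..<m}"

lemma path_edges_geodesic:
  assumes p: "geodesic x p y" and m: "m \<le> d x y"
  shows "path_edges p m \<subseteq> sep_edges x y" "card (path_edges p m) = m"
proof -
  show "path_edges p m \<subseteq> sep_edges x y"
    using p m unfolding path_edges_def by (auto simp: geodesic_def intro!: sep_edgesI)
  have lev: "d x (p j) = j" if "j \<le> m" for j
    using p m that by (auto simp: geodesic_def)
  have "inj_on (\<lambda>j. {p j, p (Suc j)}) {..<m}"
  proof (rule inj_onI)
    fix i j assume "i \<in> {..<m}" "j \<in> {..<m}" "{p i, p (Suc i)} = {p j, p (Suc j)}"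
    then have "{i, Suc i} = {j, Suc j}"
      using lev by (metis doubleton_eq_iff lessThan_iff less_imp_le_nat Suc_leI)
    then show "i = j" by (auto simp: doubleton_eq_iff)
  qed
  then show "card (path_edges p m) = m"
    by (simp add: path_edges_def card_image)
qed

lemma excess_nonneg:
  assumes "x \<in> V" "y \<in> V"
  shows "0 \<le> excess x y"
proof -
  obtain p where p: "geodesic x p y" using geodesic_exists assms .
  show ?thesis
    using card_mono[OF finite_sep_edges path_edges_geodesic(1)[OF p order.refl]]
    by (simp add: path_edges_geodesic(2)[OF p] excess_def)
qed

lemma excess_0_sep_edges:
  assumes "x \<in> V" "y \<in> V" "excess x y = 0"
  obtains p where "geodesic x p y" "sep_edges x y = path_edges p (d x y)"
proof -
  obtain p where p: "geodesic x p y" using geodesic_exists assms(1,2) .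
  have "path_edges p (d x y) = sep_edges x y"
    by (rule card_subset_eq[OF finite_sep_edges])
      (use path_edges_geodesic[OF p order.refl] assms(3) in \<open>auto simp: excess_def\<close>)
  then show thesis using that p by simp
qed

text \<open>With zero excess, the edges of one geodesic exhaust the separating edges, so any
  separating edge lies on it and determines \<open>d x y\<close>. Two separating edges that yield
  different values thus refute zero excess.\<close>

lemma excess_0_dist:
  assumes "x \<in> V" "y \<in> V" "excess x y = 0"
    and e: "{u, v} \<in> E" "d x u < d x v" "d y v < d y u"
  shows "d x y = d x u + Suc (d y v)"
proof -
  obtain p where p: "geodesic x p y" "sep_edges x y = path_edges p (d x y)"
    using excess_0_sep_edges assms(1-3) .
  have "{u, v} \<in> path_edges p (d x y)" using sep_edgesI e p by metis
  then obtain j where j: "j < d x y" "{u, v} = {p j, p (Suc j)}"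
    by (auto simp: path_edges_def)
  then have "d x (p j) = j" "d x (p (Suc j)) = Suc j" "d y (p (Suc j)) = d x y - Suc j"
    using p(1) by (auto simp: geodesic_def)
  then show ?thesis using e j by (auto simp: doubleton_eq_iff)
qed

text \<open>All separating edges lie on one geodesic, which has a single edge at each level.\<close>

lemma excess_0_unique:
  assumes "x \<in> V" "y \<in> V" "excess x y = 0"
    and e: "{u, v} \<in> E" "d x u < d x v" "d y v < d y u"
    and e': "{u', v'} \<in> E" "d x u' < d x v'" "d y v' < d y u'"
    and lev: "d x u = d x u'"
  shows "u = u' \<and> v = v'"
proof -
  obtain p where p: "geodesic x p y" "sep_edges x y = path_edges p (d x y)"
    using excess_0_sep_edges assms(1-3) .
  have on: "u = p (d x u) \<and> v = p (Suc (d x u))"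
    if e: "{u, v} \<in> E" "d x u < d x v" "d y v < d y u" for u v
  proof -
    have "{u, v} \<in> path_edges p (d x y)" using sep_edgesI e p by metis
    then obtain j where j: "j < d x y" "{u, v} = {p j, p (Suc j)}"
      by (auto simp: path_edges_def)
    then have "d x (p j) = j" "d x (p (Suc j)) = Suc j"
      using p(1) by (auto simp: geodesic_def)
    then show ?thesis using e j by (auto simp: doubleton_eq_iff)
  qed
  show ?thesis using on[OF e] on[OF e'] lev by simp
qed

section \<open>Both indices as sums over ordered pairs\<close>

lemma wiener_index_double_sum: "2 * wiener_index V E = (\<Sum>x\<in>V. \<Sum>y\<in>V. d x y)"
proof -
  let ?P = "{P. P \<subseteq> V \<and> card P = 2}"
  let ?R = "{(x, y) \<in> V \<times> V. x \<noteq> y}"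
  have fin: "finite ?R" using finite_V by (auto intro: finite_subset[of _ "V \<times> V"])
  have finP: "finite ?P" using finite_V by auto
  have "(\<Sum>x\<in>V. \<Sum>y\<in>V. d x y) = (\<Sum>(x, y)\<in>V \<times> V. d x y)"
    by (simp add: sum.cartesian_product)
  also have "\<dots> = (\<Sum>(x, y)\<in>?R. d x y)"
    by (rule sum.mono_neutral_right) (use finite_V dist_self in auto)
  also have "\<dots> = (\<Sum>P\<in>?P. \<Sum>r\<in>{r\<in>?R. {fst r, snd r} = P}. d (fst r) (snd r))"
    by (subst sum.group[OF fin finP]) (auto simp: case_prod_unfold)
  also have "\<dots> = (\<Sum>P\<in>?P. 2 * on_pair d P)"
  proof (rule sum.cong[OF refl])
    fix P assume "P \<in> ?P"
    then obtain u v where uv: "P = {u, v}" "u \<noteq> v" "u \<in> V" "v \<in> V"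
      by (auto simp: card_2_iff)
    have "{r\<in>?R. {fst r, snd r} = P} = {(u, v), (v, u)}"
      using uv by (auto simp: doubleton_eq_iff)
    then show "(\<Sum>r\<in>{r\<in>?R. {fst r, snd r} = P}. d (fst r) (snd r)) = 2 * on_pair d P"
      using uv by (simp add: on_pair_graph_dist graph_dist_commute[of V E v u])
  qed
  finally show ?thesis by (simp add: wiener_index_def sum_distrib_left)
qed

text \<open>Double counting of the triples of an edge and an ordered pair separated by it: an edge
  \<open>{u, v}\<close> separates exactly the pairs with one vertex on the side of \<open>u\<close>
  and the other on the side of \<open>v\<close>, in either order.\<close>

lemma szeged_index_double_sum:
  "2 * szeged_index V E = (\<Sum>x\<in>V. \<Sum>y\<in>V. card (sep_edges x y))"
proof -
  have "(\<Sum>x\<in>V. \<Sum>y\<in>V. card (sep_edges x y)) = (\<Sum>r\<in>V \<times> V. card {e\<in>E. e \<in> sep_edges (fst r) (snd r)})"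
  proof -
    have "{e\<in>E. e \<in> sep_edges x y} = sep_edges x y" for x y
      using sep_edges_subset by auto
    then show ?thesis by (simp add: sum.cartesian_product case_prod_unfold)
  qed
  also have "\<dots> = (\<Sum>e\<in>E. card {r\<in>V \<times> V. e \<in> sep_edges (fst r) (snd r)})"
    using finite_V finite_E by (intro sum_multicount_gen) auto
  also have "\<dots> = (\<Sum>e\<in>E. 2 * on_pair (\<lambda>u v. closer_count V E u v * closer_count V E v u) e)"
  proof (rule sum.cong[OF refl])
    fix e assume "e \<in> E"
    then obtain u v where e: "e = {u, v}" "{u, v} \<in> E" by (rule edgeE)
    let ?A = "{w\<in>V. d u w < d v w}" and ?B = "{w\<in>V. d v w < d u w}"
    have "{r\<in>V \<times> V. e \<in> sep_edges (fst r) (snd r)} = ?A \<times> ?B \<union> ?B \<times> ?A"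
      using e by (auto simp: sep_edges_iff graph_dist_commute[of V E u] graph_dist_commute[of V E v])
    moreover have "card (?A \<times> ?B \<union> ?B \<times> ?A) = card ?A * card ?B + card ?B * card ?A"
      using finite_V by (subst card_Un_disjoint) (auto simp: card_cartesian_product)
    ultimately show "card {r\<in>V \<times> V. e \<in> sep_edges (fst r) (snd r)} =
        2 * on_pair (\<lambda>u v. closer_count V E u v * closer_count V E v u) e"
      by (simp add: e on_pair_closer_count) (simp add: closer_count_def)
  qed
  finally show ?thesis by (simp add: szeged_index_def sum_distrib_left)
qed

lemma szeged_minus_wiener:
  "2 * (int (szeged_index V E) - int (wiener_index V E)) = (\<Sum>x\<in>V. \<Sum>y\<in>V. excess x y)"
proof -
  have "2 * int (szeged_index V E) = int (\<Sum>x\<in>V. \<Sum>y\<in>V. card (sep_edges x y))"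
    by (simp flip: szeged_index_double_sum)
  moreover have "2 * int (wiener_index V E) = int (\<Sum>x\<in>V. \<Sum>y\<in>V. d x y)"
    by (simp flip: wiener_index_double_sum)
  ultimately show ?thesis by (simp add: excess_def sum_subtractf)
qed

section \<open>Isometric cycles\<close>

definition two_preds :: "'a \<Rightarrow> 'a \<Rightarrow> bool" where
  "two_preds u v \<longleftrightarrow> u \<in> V \<and> v \<in> V \<and>
     (\<exists>y z. y \<noteq> z \<and> {y, v} \<in> E \<and> {z, v} \<in> E \<and> d u y < d u v \<and> d u z < d u v)"

text \<open>The cycle is unrolled to a periodic sequence, so arcs are plain index shifts.
  Prescribing the antipodal distances is enough, since they force the distances along all shorter
  arcs.\<close>

definition isometric_cycle :: "nat \<Rightarrow> (nat \<Rightarrow> 'a) \<Rightarrow> bool" where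
  "isometric_cycle k c \<longleftrightarrow> 2 \<le> k \<and>
     (\<forall>i. c (i + 2 * k) = c i \<and> {c i, c (Suc i)} \<in> E \<and> d (c i) (c (i + k)) = k)"

lemma dist_chain_le:
  assumes "x \<in> V" "\<And>i. {c i, c (Suc i)} \<in> E"
  shows "d x (c (i + j)) \<le> d x (c i) + j"
proof (induction j)
  case (Suc j)
  then show ?case using dist_edge_le[OF assms(1) assms(2)[of "i + j"]] by simp
qed simp

lemma dist_chain:
  assumes "\<And>i. {c i, c (Suc i)} \<in> E"
  shows "d (c i) (c (i + j)) \<le> j"
  using dist_chain_le[of "c i" c i j] assms edge_in_V[OF assms[of i]] by (simp add: dist_self)

text \<open>Pigeonhole: send each edge to its end farther from a root \<open>r\<close>. The root is
  never hit, so at least \<open>card V\<close> edges share fewer than \<open>card V\<close> far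
  ends.\<close>

lemma two_preds_if_many_edges:
  assumes "card V \<le> card E"
  obtains u v where "two_preds u v"
proof -
  obtain r where r: "r \<in> V" using connected by (auto simp: connected_graph_def)
  define far where "far = (\<lambda>e. SOME v. \<exists>u. e = {u, v} \<and> d r u < d r v)"
  have far: "\<exists>u. e = {u, far e} \<and> d r u < d r (far e)" if "e \<in> E" for e
  proof -
    obtain u v where "e = {u, v}" "{u, v} \<in> E" using edgeE[OF \<open>e \<in> E\<close>] by metis
    moreover from this have "d r u < d r v \<or> d r v < d r u" using dist_edge[OF r, of u v] by auto
    ultimately have "\<exists>v u. e = {u, v} \<and> d r u < d r v" by (auto simp: doubleton_eq_iff)
    then show ?thesis unfolding far_def by (rule someI_ex)
  qed
  have "far ` E \<subseteq> V - {r}"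
  proof
    fix v assume "v \<in> far ` E"
    then obtain e where "e \<in> E" "v = far e" by blast
    with far[of e] show "v \<in> V - {r}"
      using edge_subset dist_self[OF r] by fastforce
  qed
  then have "card (far ` E) \<le> card V - 1"
    using finite_V r by (metis card_Diff_singleton card_mono finite_Diff)
  moreover have "card V > 0" using r finite_V by (auto simp: card_gt_0_iff)
  ultimately have "\<not> inj_on far E" using assms card_image[of far E] by auto
  then obtain e e' where e: "e \<in> E" "e' \<in> E" "e \<noteq> e'" "far e = far e'"
    by (auto simp: inj_on_def)
  obtain y where y: "e = {y, far e}" "d r y < d r (far e)" using far[OF e(1)] by blast
  obtain z where z: "e' = {z, far e}" "d r z < d r (far e)" using far[OF e(2)] unfolding e(4)[symmetric] by blast
  note yz = y z
  have "two_preds r (far e)"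
    unfolding two_preds_def
  proof (intro conjI exI)
    show "y \<noteq> z" using yz(1,3) e(3) by metis
    show "{y, far e} \<in> E" "{z, far e} \<in> E" using yz(1,3) e(1,2) by metis+
    then show "far e \<in> V" using edge_in_V by blast
  qed (fact r yz)+
  then show thesis using that by blast
qed

text \<open>
  Two geodesics witnessing a pair \<open>u\<close>, \<open>v\<close> of minimal distance \<open>k\<close> close up to a cycle. If an
  antipodal pair on it were closer than \<open>k\<close>, the cycle would provide such a pair at distance
  \<open>k - 1\<close>.
\<close>

lemma isometric_cycle_exists:
  assumes "two_preds u v"
  obtains k c where "isometric_cycle k c"
proof -
  obtain u v where dbl: "two_preds u v"
    and min: "\<And>u' v'. two_preds u' v' \<Longrightarrow> d u v \<le> d u' v'"
    using ex_has_least_nat[of "\<lambda>(u, v). two_preds u v" "(u, v)" "\<lambda>(u, v). d u v"] assms by auto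
  define k where "k = d u v"
  obtain y z where yz: "u \<in> V" "v \<in> V" "y \<noteq> z" "{y, v} \<in> E" "{z, v} \<in> E" "d u y < k" "d u z < k"
    using dbl by (auto simp: two_preds_def k_def)
  have yzV: "y \<in> V" "z \<in> V" using yz edge_in_V by auto
  have dyz: "Suc (d u y) = k" "Suc (d u z) = k"
    using dist_edge[of u y v] dist_edge[of u z v] yz by (auto simp: k_def)
  have k2: "2 \<le> k"
  proof (rule ccontr)
    assume "\<not> 2 \<le> k"
    then have "d u y = 0" "d u z = 0" using dyz by auto
    then show False using yz yzV dist_eq_0 by metis
  qed
  obtain p q where "geodesic u p y" "geodesic u q z" using geodesic_exists yz yzV by metis
  then have p: "p 0 = u" "p (k - 1) = y" "\<And>i. i < k - 1 \<Longrightarrow> {p i, p (Suc i)} \<in> E"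
    and q: "q 0 = u" "q (k - 1) = z" "\<And>i. i < k - 1 \<Longrightarrow> {q i, q (Suc i)} \<in> E"
    using dyz by (auto simp: geodesic_def)
  \<comment> \<open>The cycle runs out along \<open>p\<close>, through \<open>v\<close> at position
    \<open>k\<close>, and back along \<open>q\<close>: position \<open>k + 1\<close> is
    \<open>z\<close> and position \<open>2 * k - 1\<close> is \<open>q 1\<close>.\<close>
  define b where "b = (\<lambda>r. if r < k then p r else if r = k then v else q (2 * k - r))"
  define c where "c = (\<lambda>i. b (i mod (2 * k)))"
  have c_per: "c (i + 2 * k) = c i" for i by (simp add: c_def)
  have c_b: "c i = b i" if "i < 2 * k" for i using that by (simp add: c_def)
  have b_edge: "{b r, b (Suc r)} \<in> E" if "Suc r < 2 * k" for r
  proof -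
    consider "Suc r < k" | "Suc r = k" | "r = k" | "k < r" by linarith
    then show ?thesis
    proof cases
      case 1 then show ?thesis using p by (simp add: b_def)
    next
      case 2 then show ?thesis using p(2) yz by (auto simp: b_def)
    next
      case 3
      then have "2 * k - Suc r = k - 1" by simp
      then show ?thesis using q(2) yz 3 by (simp add: b_def insert_commute)
    next
      case 4
      then have "{q (2 * k - Suc r), q (Suc (2 * k - Suc r))} \<in> E"
        using that by (intro q(3)) simp
      then show ?thesis using 4 that by (simp add: b_def insert_commute Suc_diff_Suc)
    qed
  qed
  have c_edge: "{c i, c (Suc i)} \<in> E" for i
  proof (cases "Suc (i mod (2 * k)) = 2 * k")
    case True
    then have i: "i mod (2 * k) = 2 * k - 1" "Suc i mod (2 * k) = 0"
      by (auto simp: mod_Suc)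
    have "c i = q 1" "c (Suc i) = q 0"
      unfolding c_def i using k2 p(1) q(1) by (auto simp: b_def)
    then show ?thesis using q(3)[of 0] k2 by (simp add: insert_commute)
  next
    case False
    then have "Suc i mod (2 * k) = Suc (i mod (2 * k))" by (simp add: mod_Suc)
    moreover have "i mod (2 * k) < 2 * k" using k2 by simp
    ultimately show ?thesis using False b_edge[of "i mod (2 * k)"] by (simp add: c_def)
  qed
  have c_V: "c i \<in> V" for i using c_edge edge_in_V by blast
  have c0: "c 0 = u" "c k = v" "c (k - 1) = y" "c (Suc k) = z"
    using k2 p q by (auto simp: c_b b_def)
  \<comment> \<open>If the sequence turned back at \<open>c (i + k + 1)\<close>, only
    \<open>k - 2\<close> steps would remain from \<open>c (i + k)\<close> to
    \<open>c i\<close>.\<close>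
  have neq: "c (i + k) \<noteq> c (i + k + 2)" if "d (c i) (c (i + k)) = k" for i
  proof
    assume eq: "c (i + k) = c (i + k + 2)"
    have "d (c (i + k + 2)) (c (i + k + 2 + (k - 2))) \<le> k - 2" by (rule dist_chain[of c, OF c_edge])
    also have "i + k + 2 + (k - 2) = i + 2 * k" using k2 by simp
    finally have "d (c i) (c (i + k)) \<le> k - 2"
      by (simp only: c_per eq graph_dist_commute[of V E "c i"])
    then show False using that k2 by simp
  qed
  \<comment> \<open>The second conjunct strengthens the induction: the two distinct neighbours of
    \<open>c (i + k)\<close> are what makes a shortcut yield \<open>two_preds\<close> for
    \<open>c (Suc i)\<close> and \<open>c (i + k)\<close>.\<close>
  have antipodal: "d (c i) (c (i + k)) = k \<and> c (i + k - 1) \<noteq> c (i + k + 1)" for i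
  proof (induction i)
    case 0
    then show ?case using c0 yz(3) by (simp add: k_def)
  next
    case (Suc i)
    let ?x = "c (Suc i)" and ?w = "c (i + k)"
    have x: "?x \<in> V" by (rule c_V)
    have le: "d ?x ?w \<le> k - 1" using dist_chain[of c, OF c_edge, of "Suc i" "k - 1"] k2 by simp
    moreover have "k \<le> Suc (d ?x ?w)"
      using Suc dist_edge_le[OF c_V[of "i + k"], of ?x "c i"] c_edge[of i]
      by (simp add: graph_dist_commute insert_commute)
    ultimately have xw: "d ?x ?w = k - 1" by simp
    have "d ?x (c (i + k + 1)) = k"
    proof (rule ccontr)
      assume "d ?x (c (i + k + 1)) \<noteq> k"
      then have lt: "d ?x (c (i + k + 1)) < d ?x ?w"
        using dist_edge[OF x c_edge[of "i + k"]] xw k2 by auto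
      have e: "{c (i + k - 1), ?w} \<in> E" using c_edge[of "i + k - 1"] k2 by simp
      have "d ?x (c (Suc i + (k - 2))) \<le> k - 2" by (rule dist_chain[of c, OF c_edge])
      moreover have "Suc i + (k - 2) = i + k - 1" using k2 by simp
      ultimately have lt': "d ?x (c (i + k - 1)) < d ?x ?w" using k2 xw by simp
      have "two_preds ?x ?w"
        unfolding two_preds_def
      proof (intro conjI exI)
        show "c (i + k - 1) \<noteq> c (i + k + 1)" using Suc by blast
        show "{c (i + k + 1), ?w} \<in> E" using c_edge[of "i + k"] by (simp add: insert_commute)
      qed (use x c_V e lt lt' in auto)
      from min[OF this] show False using xw k2 by (simp add: k_def)
    qed
    then show ?case using neq[of i] Suc by simp
  qed
  then have "isometric_cycle k c"
    using k2 c_per c_edge by (simp add: isometric_cycle_def)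
  then show thesis using that by blast
qed

text \<open>Take a vertex of the cycle farthest from \<open>u\<close>. Its two neighbours on the
  cycle are not farther, hence closer by \<open>dist_edge\<close>.\<close>

lemma two_preds_if_cycle:
  assumes "cycle_graph V' E'" "V' \<subseteq> V" "E' \<subseteq> E" "u \<in> V"
  obtains v where "v \<in> V'" "two_preds u v"
proof -
  obtain l where l: "distinct l" "3 \<le> length l" "V' = set l"
    "E' = {{l ! i, l ! (Suc i mod length l)} | i. i < length l}"
    using assms(1) by (auto simp: cycle_graph_def)
  have "V' \<noteq> {}" using l by auto
  then obtain v where v: "v \<in> V'" "\<And>w. w \<in> V' \<Longrightarrow> d u w \<le> d u v"
    using l(3) ex_has_greatest_nat[of "\<lambda>v. v \<in> V'" _ "d u" "Suc (Max (d u ` V'))"]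
    by (metis List.finite_set Max_ge finite_imageI imageI le_imp_less_Suc all_not_in_conv)
  then obtain i where i: "i < length l" "v = l ! i" using l(3) by (auto simp: in_set_conv_nth)
  define j where "j = (if i = 0 then length l - 1 else i - 1)"
  let ?y = "l ! (Suc i mod length l)" and ?z = "l ! j"
  have j: "j < length l" "Suc j mod length l = i" using i l(2) by (auto simp: j_def)
  have s: "Suc i mod length l < length l" using l(2) by (intro mod_less_divisor) linarith
  have "Suc i mod length l \<noteq> j" using i l(2) by (auto simp: j_def mod_Suc)
  then have neq: "?y \<noteq> ?z" using l(1) j(1) s by (simp add: nth_eq_iff_index_eq)
  have e: "{v, ?y} \<in> E'" "{?z, v} \<in> E'" using i j l(4) by blast+
  then have eE: "{?y, v} \<in> E" "{?z, v} \<in> E" using assms(3) by (auto simp: insert_commute)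
  have "?y \<in> V'" "?z \<in> V'" using l(3) j(1) s by auto
  then have "d u ?y < d u v" "d u ?z < d u v"
    using v(2)[of ?y] v(2)[of ?z] dist_edge[OF assms(4) eE(1)] dist_edge[OF assms(4) eE(2)] by auto
  then have "two_preds u v"
    using neq eE assms(4) v(1) assms(2) unfolding two_preds_def by blast
  then show thesis using that v(1) by blast
qed

text \<open>Both edges from the predecessors into \<open>v\<close> separate \<open>u\<close> from
  \<open>v\<close> at the same level, against \<open>excess_0_unique\<close>.\<close>

lemma excess_two_preds:
  assumes "two_preds u v"
  shows "excess u v \<noteq> 0"
proof
  assume "excess u v = 0"
  moreover have V: "u \<in> V" "v \<in> V" using assms by (auto simp: two_preds_def)
  moreover obtain y z
    where yz: "y \<noteq> z" "{y, v} \<in> E" "{z, v} \<in> E" "d u y < d u v" "d u z < d u v"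
    using assms unfolding two_preds_def by blast
  moreover have "d v v < d v y" "d v v < d v z"
    using yz dist_edge_1[of v y] dist_edge_1[of v z] dist_self[of v] V
    by (simp_all add: insert_commute)
  moreover have "d u y = d u z" using dist_edge[of u y v] dist_edge[of u z v] yz V by linarith
  ultimately show False using excess_0_unique[of u v y v z v] by blast
qed

text \<open>Ascents and descents together number \<open>l\<close>, and their difference is the net
  change of \<open>g\<close>. The equation is arranged without subtraction to stay in the natural
  numbers.\<close>

lemma card_descents:
  fixes g :: "nat \<Rightarrow> nat"
  assumes "\<And>j. g (Suc j) = Suc (g j) \<or> g j = Suc (g (Suc j))"
  shows "2 * card {j \<in> {a..<a + l}. g j = Suc (g (Suc j))} + g (a + l) = l + g a"
proof (induction l)
  case (Suc l)
  let ?A = "\<lambda>l. {j \<in> {a..<a + l}. g j = Suc (g (Suc j))}"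
  have "?A (Suc l) = (if g (a + l) = Suc (g (Suc (a + l))) then insert (a + l) (?A l) else ?A l)"
    by (auto simp: less_Suc_eq)
  then have "card (?A (Suc l)) = card (?A l) + (if g (a + l) = Suc (g (Suc (a + l))) then 1 else 0)"
    by auto
  then show ?case using Suc assms[of "a + l"] by (auto split: if_splits)
qed simp

lemma card_ascents:
  fixes g :: "nat \<Rightarrow> nat"
  assumes "\<And>j. g (Suc j) = Suc (g j) \<or> g j = Suc (g (Suc j))"
  shows "2 * card {j \<in> {a..<a + l}. g (Suc j) = Suc (g j)} + g a = l + g (a + l)"
proof (induction l)
  case (Suc l)
  let ?A = "\<lambda>l. {j \<in> {a..<a + l}. g (Suc j) = Suc (g j)}"
  have "?A (Suc l) = (if g (Suc (a + l)) = Suc (g (a + l)) then insert (a + l) (?A l) else ?A l)"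
    by (auto simp: less_Suc_eq)
  then have "card (?A (Suc l)) = card (?A l) + (if g (Suc (a + l)) = Suc (g (a + l)) then 1 else 0)"
    by auto
  then show ?case using Suc assms[of "a + l"] by (auto split: if_splits)
qed simp

section \<open>Distances and separating edges on an isometric cycle\<close>

context
  fixes k :: nat and c :: "nat \<Rightarrow> 'a"
  assumes cycle: "isometric_cycle k c"
begin

lemma k_ge_2: "2 \<le> k"
  using cycle by (simp add: isometric_cycle_def)

lemma cycle_edge: "{c i, c (Suc i)} \<in> E"
  using cycle by (simp add: isometric_cycle_def)

lemma cycle_in_V: "c i \<in> V"
  using cycle_edge edge_in_V by blast

lemma cycle_period: "c (i + 2 * k) = c i"
  using cycle by (simp add: isometric_cycle_def)

text \<open>A shortcut to \<open>c (i + j)\<close>, continued along the cycle, would shorten the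
  distance between the antipodes \<open>c i\<close> and \<open>c (i + k)\<close>.\<close>

lemma cycle_dist:
  assumes "j \<le> k"
  shows "d (c i) (c (i + j)) = j"
proof -
  have "d (c i) (c (i + k)) = k" using cycle by (simp add: isometric_cycle_def)
  moreover have "d (c i) (c (i + j + (k - j))) \<le> d (c i) (c (i + j)) + (k - j)"
    by (rule dist_chain_le[of _ c, OF cycle_in_V cycle_edge])
  ultimately have "j \<le> d (c i) (c (i + j))" using assms by simp
  then show ?thesis using dist_chain[of c i j] cycle_edge by (simp add: le_antisym)
qed

lemma cycle_distinct:
  assumes "i < j" "j < i + 2 * k"
  shows "c i \<noteq> c j"
proof
  assume eq: "c i = c j"
  show False
  proof (cases "j \<le> i + k")
    case True
    then have "j - i \<le> k" by arith
    then show False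
      using cycle_dist[of "j - i" i] assms eq dist_self[OF cycle_in_V] by simp
  next
    case False
    then have "d (c j) (c (j + (i + 2 * k - j))) = i + 2 * k - j"
      by (intro cycle_dist) simp
    then show False using assms eq dist_self[OF cycle_in_V] cycle_period by simp
  qed
qed

lemma cycle_inj: "inj_on c {..<2 * k}"
  by (rule linorder_inj_onI) (use cycle_distinct in auto)

lemma cycle_edges_inj: "inj_on (\<lambda>j. {c j, c (Suc j)}) {i..<i + 2 * k}"
proof (rule linorder_inj_onI)
  fix j j' assume j: "j < j'" "j \<in> {i..<i + 2 * k}" "j' \<in> {i..<i + 2 * k}"
  have "c j \<noteq> c j'" using j by (intro cycle_distinct) auto
  moreover have "c (Suc j) \<noteq> c j'" if "j' \<noteq> Suc j"
    using j that by (intro cycle_distinct) auto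
  \<comment> \<open>Settles \<open>j' = Suc j\<close>, where the edges share a vertex and could only
    coincide with their ends swapped.\<close>
  moreover have "c j \<noteq> c (Suc (Suc j))" using k_ge_2 by (intro cycle_distinct) auto
  ultimately show "{c j, c (Suc j)} \<noteq> {c j', c (Suc j')}"
    by (auto simp: doubleton_eq_iff)
qed auto

lemma cycle_mod: "c (i + j) = c (i + j mod (2 * k))"
proof (induction j rule: less_induct)
  case (less j)
  show ?case
  proof (cases "j < 2 * k")
    case False
    then have "c (i + j) = c (i + (j - 2 * k))" using cycle_period[of "i + (j - 2 * k)"] by simp
    then show ?thesis using less[of "j - 2 * k"] False k_ge_2 by (simp add: le_mod_geq)
  qed simp
qed

lemma cycle_index:
  obtains j where "j < 2 * k" "c l = c (i + j)"
proof -
  \<comment> \<open>A multiple of the period that is at least \<open>i\<close> is added, so that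
    subtracting \<open>i\<close> loses nothing.\<close>
  have "c l = c (l + 2 * k * i)" using cycle_mod[of l "2 * k * i"] by simp
  also have "l + 2 * k * i = i + (l + 2 * k * i - i)"
    using mult_le_mono1[of 1 "2 * k" i] k_ge_2 by linarith
  also have "c \<dots> = c (i + (l + 2 * k * i - i) mod (2 * k))" by (rule cycle_mod)
  finally show thesis by (rule that[rotated]) (use k_ge_2 in simp)
qed

text \<open>
  The edges of the cycle separating \<open>x\<close> from \<open>c i\<close> are those along which the distance from \<open>x\<close>
  decreases on the half cycle from \<open>c i\<close> to its antipode, or increases on the way back. A geodesic
  from \<open>x\<close> to \<open>c i\<close> adds \<open>m\<close> separating edges at levels that the cycle does not reach.
\<close>

lemma card_sep_edges_cycle_ge:
  assumes x: "x \<in> V" and m: "\<And>j. m \<le> d x (c j)"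
  shows "k + m + d x (c i) \<le> card (sep_edges x (c i)) + d x (c (i + k))"
proof -
  define f where "f = (\<lambda>j. d x (c j))"
  have f: "f (Suc j) = Suc (f j) \<or> f j = Suc (f (Suc j))" for j
    unfolding f_def by (rule dist_edge[OF x cycle_edge])
  define D where "D = {j \<in> {i..<i + k}. f j = Suc (f (Suc j))}"
  define U where "U = {j \<in> {i + k..<i + k + k}. f (Suc j) = Suc (f j)}"
  have "2 * card D + f (i + k) = k + f i"
    unfolding D_def by (rule card_descents) (rule f)
  moreover have "2 * card U + f (i + k) = k + f i"
    unfolding U_def using card_ascents[of f "i + k" k, OF f] cycle_period[of i]
    by (simp add: f_def mult_2 add.assoc)
  moreover have "card (D \<union> U) = card D + card U"
    by (rule card_Un_disjoint) (auto simp: D_def U_def)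
  ultimately have DU: "card (D \<union> U) + f (i + k) = k + f i" by simp
  define C where "C = (\<lambda>j. {c j, c (Suc j)}) ` (D \<union> U)"
  have "inj_on (\<lambda>j. {c j, c (Suc j)}) (D \<union> U)"
    by (rule inj_on_subset[OF cycle_edges_inj[of i]]) (auto simp: D_def U_def)
  then have card_C: "card C = card (D \<union> U)" by (simp add: C_def card_image)
  have C_sub: "C \<subseteq> sep_edges x (c i)"
  proof -
    have "{c j, c (Suc j)} \<in> sep_edges x (c i)" if "j \<in> D" for j
    proof -
      have j: "i \<le> j" "j < i + k" using that by (auto simp: D_def)
      then have "d (c i) (c (i + (j - i))) = j - i" "d (c i) (c (i + (Suc j - i))) = Suc j - i"
        using cycle_dist[of "j - i" i] cycle_dist[of "Suc j - i" i] by linarith+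
      then have "d (c i) (c j) < d (c i) (c (Suc j))" using j by simp
      then have "{c (Suc j), c j} \<in> sep_edges x (c i)"
        using that cycle_edge[of j] by (intro sep_edgesI) (auto simp: D_def f_def insert_commute)
      then show ?thesis by (simp add: insert_commute)
    qed
    moreover have "{c j, c (Suc j)} \<in> sep_edges x (c i)" if "j \<in> U" for j
    proof -
      have j: "i + k \<le> j" "j < i + k + k" using that by (auto simp: U_def)
      then have "d (c j) (c (j + (i + 2 * k - j))) = i + 2 * k - j"
        "d (c (Suc j)) (c (Suc j + (i + 2 * k - Suc j))) = i + 2 * k - Suc j"
        using cycle_dist[of "i + 2 * k - j" j] cycle_dist[of "i + 2 * k - Suc j" "Suc j"] by linarith+
      then have "d (c i) (c (Suc j)) < d (c i) (c j)"
        using j cycle_period[of i]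
        by (simp add: graph_dist_commute[of V E "c i"])
      then show ?thesis
        using that cycle_edge[of j] by (intro sep_edgesI) (auto simp: U_def f_def)
    qed
    ultimately show ?thesis by (auto simp: C_def)
  qed
  obtain p where p: "geodesic x p (c i)" using geodesic_exists x cycle_in_V .
  define P where "P = path_edges p m"
  have P: "P \<subseteq> sep_edges x (c i)" "card P = m"
    unfolding P_def using path_edges_geodesic[OF p m] by auto
  have "C \<inter> P = {}"
  proof -
    have "d x w \<le> m" if "e \<in> P" "w \<in> e" for e w
      using that p m[of i] by (auto simp: P_def path_edges_def geodesic_def)
    moreover have "\<exists>w\<in>e. m < d x w" if "e \<in> C" for e
    proof -
      obtain j where "e = {c j, c (Suc j)}" using \<open>e \<in> C\<close> by (auto simp: C_def)
      then show ?thesis using f[of j] m[of j] m[of "Suc j"] by (auto simp: f_def)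
    qed
    ultimately show ?thesis by (meson disjoint_iff leD)
  qed
  moreover have "finite C" "finite P"
    using C_sub P(1) by (auto intro: finite_subset[OF _ finite_sep_edges])
  ultimately have "card (C \<union> P) = card C + card P" by (intro card_Un_disjoint)
  moreover have "card (C \<union> P) \<le> card (sep_edges x (c i))"
    by (rule card_mono) (use C_sub P finite_sep_edges in auto)
  ultimately show ?thesis using DU card_C P(2) by (simp add: f_def)
qed

text \<open>The vertex \<open>c l\<close> lies on one of the two half cycles between the antipodes
  and cuts it into arcs of lengths \<open>n\<close> and \<open>k - n\<close>; the triangle
  inequality through \<open>c l\<close> applies to both.\<close>

lemma antipodal_dist_sum:
  assumes x: "x \<in> V"
  shows "d x (c i) + d x (c (i + k)) \<le> 2 * d x (c l) + k"
proof -
  have main: "d x (c i) + d x (c (i + k)) \<le> 2 * d x (c (i + j)) + k" if "j < 2 * k" for i j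
  proof -
    have near: "d x (c a) \<le> d x (c b) + n" if "d (c b) (c a) \<le> n" for a b n
      using dist_triangle[OF x cycle_in_V[of b] cycle_in_V[of a]] that by simp
    have "\<exists>n \<le> k. d (c (i + j)) (c i) \<le> n \<and> d (c (i + j)) (c (i + k)) \<le> k - n"
    proof (cases "j \<le> k")
      case True
      then have "d (c (i + j)) (c (i + j + (k - j))) \<le> k - j"
        using dist_chain[of c] cycle_edge by blast
      then show ?thesis
        using True cycle_dist[of j i] by (intro exI[of _ j]) (simp add: graph_dist_commute)
    next
      case False
      then have "d (c (i + j)) (c (i + j + (2 * k - j))) \<le> 2 * k - j"
        "d (c (i + k)) (c (i + k + (j - k))) \<le> j - k"
        using dist_chain[of c] cycle_edge by blast+
      then show ?thesis
        using False that cycle_period[of i]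
        by (intro exI[of _ "2 * k - j"]) (simp add: graph_dist_commute)
    qed
    then obtain n where "n \<le> k" "d (c (i + j)) (c i) \<le> n" "d (c (i + j)) (c (i + k)) \<le> k - n"
      by blast
    then show ?thesis using near[of "i + j" i n] near[of "i + j" "i + k" "k - n"] by linarith
  qed
  obtain j where "j < 2 * k" "c l = c (i + j)" by (rule cycle_index)
  then show ?thesis using main[of j i] by simp
qed

text \<open>Let \<open>m\<close> be the distance from \<open>x\<close> to the cycle. Adding
  \<open>card_sep_edges_cycle_ge\<close> for both antipodes cancels the distances and leaves at
  least \<open>2 * k + 2 * m\<close> separating edges, while \<open>antipodal_dist_sum\<close>
  bounds the two distances by \<open>2 * m + k\<close>.\<close>

lemma excess_antipodal_ge:
  assumes x: "x \<in> V"
  shows "int k \<le> excess x (c i) + excess x (c (i + k))"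
proof -
  let ?f = "\<lambda>j. d x (c j)"
  obtain l where l: "\<And>j. ?f l \<le> ?f j"
    using ex_has_least_nat[of "\<lambda>_. True" _ ?f] by auto
  have "?f (i + k + k) = ?f i" using cycle_period[of i] by (simp add: add.assoc mult_2)
  then show ?thesis
    using card_sep_edges_cycle_ge[OF x l, of i] card_sep_edges_cycle_ge[OF x l, of "i + k"]
      antipodal_dist_sum[OF x, of i l]
    by (simp add: excess_def)
qed

section \<open>Summing the excess over all pairs\<close>

lemma sum_excess_cycle: "(\<Sum>y\<in>c ` {..<2 * k}. excess x y) = (\<Sum>i<k. excess x (c i) + excess x (c (i + k)))"
proof -
  have add: "(\<Sum>i<k + n. f i) = (\<Sum>i<k. f i) + (\<Sum>i<n. f (i + k))" for n and f :: "nat \<Rightarrow> int"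
    by (induction n) (auto simp: add_ac)
  have "(\<Sum>y\<in>c ` {..<2 * k}. excess x y) = (\<Sum>i<k + k. excess x (c i))"
    using cycle_inj by (simp add: sum.reindex mult_2)
  also have "\<dots> = (\<Sum>i<k. excess x (c i)) + (\<Sum>i<k. excess x (c (i + k)))"
    by (rule add)
  finally show ?thesis by (simp add: sum.distrib)
qed

lemma sum_excess_cycle_ge:
  assumes "x \<in> V"
  shows "int k ^ 2 \<le> (\<Sum>y\<in>c ` {..<2 * k}. excess x y)"
proof -
  have "(\<Sum>i<k. int k) \<le> (\<Sum>i<k. excess x (c i) + excess x (c (i + k)))"
    by (rule sum_mono) (rule excess_antipodal_ge[OF assms])
  then show ?thesis by (simp add: sum_excess_cycle power2_eq_square)
qed

text \<open>The block with rows in \<open>C\<close> and columns outside is replaced by its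
  transpose, so the first two terms consist of row sums over \<open>C\<close>, which are bounded
  uniformly.\<close>

lemma total_excess_split:
  defines "C \<equiv> c ` {..<2 * k}"
  shows "(\<Sum>x\<in>V. \<Sum>y\<in>V. excess x y) =
    (\<Sum>x\<in>V. \<Sum>y\<in>C. excess x y) + (\<Sum>x\<in>V - C. \<Sum>y\<in>C. excess x y) + (\<Sum>x\<in>V - C. \<Sum>y\<in>V - C. excess x y)"
proof -
  have C: "C \<subseteq> V" using cycle_in_V by (auto simp: C_def)
  have split: "sum f V = sum f (V - C) + sum f C" for f :: "'a \<Rightarrow> int"
    by (rule sum.subset_diff[OF C finite_V])
  have "(\<Sum>x\<in>C. \<Sum>y\<in>V - C. excess x y) = (\<Sum>x\<in>V - C. \<Sum>y\<in>C. excess x y)"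
    by (subst sum.swap) (simp add: excess_commute)
  moreover have "(\<Sum>x\<in>V. \<Sum>y\<in>V. excess x y) = (\<Sum>x\<in>V. \<Sum>y\<in>V - C. excess x y) + (\<Sum>x\<in>V. \<Sum>y\<in>C. excess x y)"
    by (simp add: split[of "excess _"] sum.distrib)
  moreover note split[of "\<lambda>x. \<Sum>y\<in>V - C. excess x y"]
  ultimately show ?thesis by simp
qed

lemma card_cycle: "card (c ` {..<2 * k}) = 2 * k"
  using card_image[OF cycle_inj] by simp

lemma card_V_ge: "2 * k \<le> card V"
  using card_mono[of V "c ` {..<2 * k}"] cycle_in_V finite_V card_cycle by auto

lemma total_excess_ge: "2 * int k ^ 2 * (int (card V) - int k) \<le> (\<Sum>x\<in>V. \<Sum>y\<in>V. excess x y)"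
proof -
  let ?C = "c ` {..<2 * k}"
  have C: "?C \<subseteq> V" using cycle_in_V by auto
  have "card (V - ?C) = card V - 2 * k" by (subst card_Diff_subset) (use C card_cycle in auto)
  then have card_diff: "int (card (V - ?C)) = int (card V) - 2 * int k" using card_V_ge by simp
  have "(\<Sum>x\<in>A. int k ^ 2) \<le> (\<Sum>x\<in>A. \<Sum>y\<in>?C. excess x y)" if "A \<subseteq> V" for A
    by (rule sum_mono) (use that sum_excess_cycle_ge in auto)
  from this[of V] this[of "V - ?C"]
  have "int (card V) * int k ^ 2 \<le> (\<Sum>x\<in>V. \<Sum>y\<in>?C. excess x y)"
    "int (card (V - ?C)) * int k ^ 2 \<le> (\<Sum>x\<in>V - ?C. \<Sum>y\<in>?C. excess x y)" by simp_all
  note this(1) this(2)[unfolded card_diff]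
  moreover have "0 \<le> (\<Sum>x\<in>V - ?C. \<Sum>y\<in>V - ?C. excess x y)"
    by (intro sum_nonneg excess_nonneg) auto
  moreover have "2 * int k ^ 2 * (int (card V) - int k) =
      int (card V) * int k ^ 2 + (int (card V) - 2 * int k) * int k ^ 2"
    by (simp add: algebra_simps)
  ultimately show ?thesis unfolding total_excess_split by linarith
qed

lemma total_excess_ge_linear:
  "8 * int (card V) - 16 \<le> (\<Sum>x\<in>V. \<Sum>y\<in>V. excess x y)"
  "k \<noteq> 2 \<Longrightarrow> 8 * int (card V) - 16 < (\<Sum>x\<in>V. \<Sum>y\<in>V. excess x y)"
proof -
  let ?n = "int (card V)" and ?k = "int k"
  have n: "2 * ?k \<le> ?n" "2 \<le> ?k" using card_V_ge k_ge_2 by linarith+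
  \<comment> \<open>The difference of the two bounds vanishes at \<open>k = 2\<close>; splitting off
    \<open>k - 2\<close> leaves a factor that is positive because \<open>k + 2\<close> is at least 4
    and \<open>n - k\<close> at least 2.\<close>
  have eq: "2 * ?k ^ 2 * (?n - ?k) - (8 * ?n - 16) = 2 * ((?k - 2) * ((?k + 2) * (?n - ?k) - 4))"
    by (simp add: algebra_simps power2_eq_square)
  have "4 * 2 \<le> (?k + 2) * (?n - ?k)" using n by (intro mult_mono) auto
  then have p: "0 < (?k + 2) * (?n - ?k) - 4" by linarith
  have "0 \<le> (?k - 2) * ((?k + 2) * (?n - ?k) - 4)"
    using n p by (intro mult_nonneg_nonneg) linarith+
  moreover have "0 < (?k - 2) * ((?k + 2) * (?n - ?k) - 4)" if "k \<noteq> 2"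
    using n p that by (intro mult_pos_pos) linarith+
  ultimately show "8 * ?n - 16 \<le> (\<Sum>x\<in>V. \<Sum>y\<in>V. excess x y)"
    "k \<noteq> 2 \<Longrightarrow> 8 * ?n - 16 < (\<Sum>x\<in>V. \<Sum>y\<in>V. excess x y)"
    using eq total_excess_ge by linarith+
qed

lemma cycle_antipodal_sum: "d (c i) (c j) + d (c i) (c (j + k)) = k"
proof (rule antisym)
  show "d (c i) (c j) + d (c i) (c (j + k)) \<le> k"
    using antipodal_dist_sum[OF cycle_in_V, of i j i] dist_self[OF cycle_in_V] by simp
  show "k \<le> d (c i) (c j) + d (c i) (c (j + k))"
    using dist_triangle[of "c j" "c i" "c (j + k)"] cycle_in_V cycle_dist[of k j]
    by (simp add: graph_dist_commute[of V E "c j"])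
qed

lemma cycle_graph_isometric: "cycle_graph (c ` {..<2 * k}) (path_edges c (2 * k))"
proof -
  let ?l = "map c [0..<2 * k]"
  have "distinct ?l" using cycle_inj by (simp add: distinct_map atLeast0LessThan)
  moreover have "3 \<le> length ?l" using k_ge_2 by simp
  moreover have "c ` {..<2 * k} = set ?l" by (simp add: atLeast0LessThan)
  moreover have "path_edges c (2 * k) = {{?l ! i, ?l ! (Suc i mod length ?l)} | i. i < length ?l}"
  proof -
    have "path_edges c (2 * k) = (\<lambda>i. {?l ! i, ?l ! (Suc i mod length ?l)}) ` {..<length ?l}"
      unfolding path_edges_def
    proof (rule image_cong)
      show "{c i, c (Suc i)} = {?l ! i, ?l ! (Suc i mod length ?l)}" if "i \<in> {..<length ?l}" for i
        using that cycle_mod[of 0 "Suc i"] k_ge_2 by simp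
    qed simp
    then show ?thesis by blast
  qed
  ultimately show ?thesis unfolding cycle_graph_def by blast
qed

text \<open>An isometric cycle has no chord: adjacent vertices have distance 1, so the shorter arc
  between them is a single edge.\<close>

lemma cycle_edges_induced:
  assumes "u \<in> c ` {..<2 * k}" "v \<in> c ` {..<2 * k}" "{u, v} \<in> E"
  shows "{u, v} \<in> path_edges c (2 * k)"
proof -
  have mem: "{c i, c (Suc i)} \<in> path_edges c (2 * k)" for i
  proof -
    define r where "r = i mod (2 * k)"
    have "r < 2 * k" using k_ge_2 by (simp add: r_def)
    then have "{c r, c (Suc r)} \<in> path_edges c (2 * k)" by (auto simp: path_edges_def)
    moreover have "c (Suc i) = c (Suc r)" "c i = c r"
      using cycle_mod[of 1 i] cycle_mod[of 0 i] by (simp_all add: r_def)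
    ultimately show ?thesis by simp
  qed
  obtain i l where i: "u = c i" "v = c l" using assms by blast
  obtain j where j: "j < 2 * k" "c l = c (i + j)" by (rule cycle_index)
  have d1: "d u v = 1" using assms(3) by (rule dist_edge_1)
  show ?thesis
  proof (cases "j \<le> k")
    case True
    then have "j = 1" using cycle_dist[of j i] d1 i j by simp
    then show ?thesis using mem[of i] i j by simp
  next
    case False
    then have "d (c (i + j)) (c (i + j + (2 * k - j))) = 2 * k - j" by (intro cycle_dist) simp
    then have "2 * k - j = 1"
      using d1 i j cycle_period[of i] by (simp add: graph_dist_commute[of V E "c i" "c (i + j)"])
    then have "i + 2 * k = Suc (i + j)" using j by simp
    then have "c i = c (Suc (i + j))" using cycle_period[of i] by simp
    then show ?thesis using mem[of "i + j"] i j by (simp add: insert_commute)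
  qed
qed

subsection \<open>The case of equality\<close>

context
  assumes extremal: "(\<Sum>x\<in>V. \<Sum>y\<in>V. excess x y) = 2 * int k ^ 2 * (int (card V) - int k)"
begin

text \<open>The lower bound on the total drops only nonnegative amounts: the surplus of each row sum
  over \<open>C\<close> above \<open>k\<^sup>2\<close>, and the excesses of pairs outside
  \<open>C\<close>. Equality makes each of them vanish.\<close>

lemma extremal_sums:
  defines "C \<equiv> c ` {..<2 * k}"
  shows "x \<in> V \<Longrightarrow> (\<Sum>y\<in>C. excess x y) = int k ^ 2"
    and "x \<in> V - C \<Longrightarrow> y \<in> V - C \<Longrightarrow> excess x y = 0"
proof -
  have C: "C \<subseteq> V" "card C = 2 * k" using cycle_in_V card_cycle by (auto simp: C_def)
  then have fin: "finite C" using finite_V finite_subset by blast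
  have "card (V - C) = card V - 2 * k" using C fin by (simp add: card_Diff_subset)
  then have card_diff: "int (card (V - C)) = int (card V) - 2 * int k" using card_V_ge by simp
  let ?f = "\<lambda>x. (\<Sum>y\<in>C. excess x y) - int k ^ 2"
  have f: "0 \<le> ?f x" if "x \<in> V" for x
    using sum_excess_cycle_ge[OF that] by (simp add: C_def)
  have g: "0 \<le> (\<Sum>y\<in>V - C. excess x y)" if "x \<in> V" for x
    using that by (intro sum_nonneg excess_nonneg) auto
  have "(\<Sum>x\<in>V. ?f x) + (\<Sum>x\<in>V - C. ?f x) + (\<Sum>x\<in>V - C. \<Sum>y\<in>V - C. excess x y) = 0"
    unfolding sum_subtractf using extremal[unfolded total_excess_split, folded C_def]
    by (simp add: card_diff) (simp add: algebra_simps)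
  moreover have "0 \<le> (\<Sum>x\<in>V. ?f x)" "0 \<le> (\<Sum>x\<in>V - C. ?f x)"
    "0 \<le> (\<Sum>x\<in>V - C. \<Sum>y\<in>V - C. excess x y)"
    using f g by (auto intro!: sum_nonneg excess_nonneg)
  ultimately have 0: "(\<Sum>x\<in>V. ?f x) = 0" "(\<Sum>x\<in>V - C. \<Sum>y\<in>V - C. excess x y) = 0"
    by linarith+
  show "(\<Sum>y\<in>C. excess x y) = int k ^ 2" if "x \<in> V"
    using 0(1) sum_nonneg_eq_0_iff[OF finite_V f] that by simp
  show "excess x y = 0" if "x \<in> V - C" "y \<in> V - C"
  proof -
    have "(\<Sum>y\<in>V - C. excess x y) = 0"
      using 0(2) sum_nonneg_eq_0_iff[of "V - C" "\<lambda>x. \<Sum>y\<in>V - C. excess x y"] g finite_V that by simp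
    then show ?thesis
      using sum_nonneg_eq_0_iff[of "V - C" "excess x"] excess_nonneg finite_V that by simp
  qed
qed

lemma extremal_antipodal:
  assumes x: "x \<in> V"
  shows "excess x (c i) + excess x (c (i + k)) = int k"
proof -
  let ?h = "\<lambda>i. excess x (c i) + excess x (c (i + k))"
  have "(\<Sum>i<k. ?h i - int k) = 0"
    using extremal_sums(1)[OF x] sum_excess_cycle[of x] by (simp add: sum_subtractf power2_eq_square)
  then have lt: "?h i = int k" if "i < k" for i
    using sum_nonneg_eq_0_iff[of "{..<k}" "\<lambda>i. ?h i - int k"] excess_antipodal_ge[OF x] that by simp
  define r where "r = i mod (2 * k)"
  have r: "r < 2 * k" using k_ge_2 by (simp add: r_def)
  have ci: "c i = c r" using cycle_mod[of 0 i] by (simp add: r_def)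
  have cik: "c (i + k) = c (r + k)" using cycle_mod[of k i] by (simp add: r_def add.commute)
  show ?thesis
  proof (cases "r < k")
    case True
    then show ?thesis using lt ci cik by simp
  next
    case False
    then have "c (r + k) = c (r - k)" using cycle_period[of "r - k"] by (simp add: mult_2)
    then show ?thesis using lt[of "r - k"] False r ci cik by (simp add: add.commute)
  qed
qed

text \<open>The gate is a closest vertex \<open>c l\<close> of the cycle. Since the excesses of two
  antipodes now sum up to exactly \<open>k\<close>, their individual lower bounds force the two
  distances from \<open>x\<close> to sum up to at least \<open>2 * d x (c l) + k\<close>, which is
  the sum of the two triangle bounds through \<open>c l\<close>; hence both of these are tight. The
  antipode of \<open>c l\<close> already takes the whole excess \<open>k\<close>, which leaves none
  for \<open>c l\<close>.\<close>

lemma extremal_gate: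
  assumes x: "x \<in> V"
  shows "\<exists>l. (\<forall>j. d x (c j) = d x (c l) + d (c l) (c j)) \<and> excess x (c l) = 0"
proof -
  let ?f = "\<lambda>j. d x (c j)"
  obtain l where l: "\<And>j. ?f l \<le> ?f j"
    using ex_has_least_nat[of "\<lambda>_. True" _ ?f] by auto
  have ge: "int k + int (?f l) - int (?f i) \<le> excess x (c (i + k))" for i
    using card_sep_edges_cycle_ge[OF x l, of "i + k"] cycle_period[of i]
    by (simp add: excess_def add.assoc mult_2)
  have ge': "int k + int (?f l) - int (?f (i + k)) \<le> excess x (c i)" for i
    using card_sep_edges_cycle_ge[OF x l, of i] by (simp add: excess_def)
  have "?f j = ?f l + d (c l) (c j)" for j
    using ge[of j] ge'[of j] extremal_antipodal[OF x, of j] cycle_antipodal_sum[of l j]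
      dist_triangle[OF x cycle_in_V[of l] cycle_in_V[of j]]
      dist_triangle[OF x cycle_in_V[of l] cycle_in_V[of "j + k"]]
    by linarith
  moreover have "excess x (c l) = 0"
    using ge[of l] extremal_antipodal[OF x, of l] excess_nonneg[OF x cycle_in_V, of l] by linarith
  ultimately show ?thesis by blast
qed

text \<open>Between different gates, both arcs of the cycle contain edges separating
  \<open>x\<close> from \<open>y\<close>, too many for zero excess. The claim inside treats gates at
  distance \<open>r\<close> along the cycle.\<close>

lemma extremal_gate_unique:
  defines "C \<equiv> c ` {..<2 * k}"
  assumes x: "x \<in> V - C" "\<And>j. d x (c j) = d x (c a) + d (c a) (c j)"
    and y: "y \<in> V - C" "\<And>j. d y (c j) = d y (c b) + d (c b) (c j)"
  shows "c a = c b"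
proof (rule ccontr)
  assume "c a \<noteq> c b"
  have *: False
    if x: "x \<in> V - C" "\<And>j. d x (c j) = d x (c a) + d (c a) (c j)"
      and y: "y \<in> V - C" "\<And>j. d y (c j) = d y (c b) + d (c b) (c j)"
      and r: "c b = c (a + r)" "0 < r" "r \<le> k" for x y a b r
  proof -
    have V: "x \<in> V" "y \<in> V" and ex: "excess x y = 0"
      using x y extremal_sums(2) by (auto simp: C_def)
    have a: "d (c a) (c (a + j)) = j" if "j \<le> k" for j using cycle_dist[OF that] .
    have b: "d (c b) (c (a + r + j)) = j" if "j \<le> k" for j using that r by (simp add: cycle_dist)
    have b': "d (c b) (c (a + j)) = r - j" if "j \<le> r" for j
      using cycle_dist[of "r - j" "a + j"] that r by (simp add: graph_dist_commute)
    have dx: "d x (c (a + j)) = d x (c a) + j" if "j \<le> k" for j using x(2)[of "a + j"] a[OF that] by simp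
    have e1: "{c a, c (a + 1)} \<in> E" using cycle_edge[of a] by simp
    have x1: "d x (c a) < d x (c (a + 1))" using dx[of 1] k_ge_2 by simp
    have y1: "d y (c (a + 1)) < d y (c a)"
      using y(2)[of "a + 1"] y(2)[of a] b'[of 0] b'[of 1] r by simp
    have "d x y = d x (c a) + Suc (d y (c (a + 1)))"
      by (rule excess_0_dist[OF V ex e1 x1 y1])
    then have dxy: "d x y = d x (c a) + d y (c b) + r" using y(2)[of "a + 1"] b'[of 1] r by simp
    show False
    proof (cases "r = k")
      case False
      \<comment> \<open>This edge lies on the longer arc and leads to the antipode of
        \<open>c a\<close>. It would give \<open>d x y\<close> the cycle part
        \<open>2 * k - r\<close>, whereas the first edge gives \<open>r\<close>.\<close>
      let ?u = "c (a + k + 1)" and ?v = "c (a + k)"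
      have e2: "{?u, ?v} \<in> E" using cycle_edge[of "a + k"] by (simp add: insert_commute)
      have "d ?u (c (a + k + 1 + (k - 1))) = k - 1" by (rule cycle_dist) simp
      also have "a + k + 1 + (k - 1) = a + 2 * k" using k_ge_2 by simp
      finally have "d (c a) ?u = k - 1" using cycle_period[of a] by (simp add: graph_dist_commute)
      then have u: "d x ?u = d x (c a) + (k - 1)" using x(2)[of "a + k + 1"] by simp
      then have x2: "d x ?u < d x ?v" using dx[of k] k_ge_2 by simp
      have "d y ?v = d y (c b) + (k - r)" using y(2)[of "a + k"] b[of "k - r"] r by simp
      moreover have "d y ?u = d y (c b) + Suc (k - r)"
        using y(2)[of "a + k + 1"] b[of "Suc (k - r)"] r by simp
      ultimately have y2: "d y ?v < d y ?u" and v: "d y ?v = d y (c b) + (k - r)" by simp_all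
      show False using excess_0_dist[OF V ex e2 x2 y2] u v dxy False r k_ge_2 by simp
    next
      case True
      \<comment> \<open>For antipodal gates the two arcs are equally long; instead, both edges of
        the cycle at \<open>c a\<close> separate at the same level.\<close>
      let ?u = "c (a + (2 * k - 1))"
      have "{?u, c (Suc (a + (2 * k - 1)))} \<in> E" by (rule cycle_edge)
      then have e2: "{c a, ?u} \<in> E" using cycle_period[of a] k_ge_2 by (simp add: insert_commute)
      have "d (c a) ?u = 1" by (rule dist_edge_1[OF e2])
      then have x2: "d x (c a) < d x ?u" using x(2)[of "a + (2 * k - 1)"] by simp
      have "d (c b) ?u = k - 1" using b[of "k - 1"] True k_ge_2 by (simp add: mult_2 add.assoc)
      then have y2: "d y ?u < d y (c a)"
        using y(2)[of "a + (2 * k - 1)"] y(2)[of a] b'[of 0] r True k_ge_2 by simp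
      have "c (a + 1) = ?u" using excess_0_unique[OF V ex e1 x1 y1 e2 x2 y2] by simp
      moreover have "c (a + 1) \<noteq> ?u" using k_ge_2 by (intro cycle_distinct) auto
      ultimately show False by simp
    qed
  qed
  obtain r where r: "r < 2 * k" "c b = c (a + r)" by (rule cycle_index)
  have "r \<noteq> 0" using r(2) \<open>c a \<noteq> c b\<close> by (cases r) auto
  show False
  proof (cases "r \<le> k")
    case True
    then show False using *[OF x y r(2)] \<open>r \<noteq> 0\<close> by simp
  next
    case False
    \<comment> \<open>The other arc is the shorter one, so the roles of \<open>x\<close> and
      \<open>y\<close> are exchanged.\<close>
    have "c (a + r + (2 * k - r)) = c a" using cycle_period[of a] r by simp
    then have ca: "c a = c (a + r + (2 * k - r))" by simp
    have yr: "d y (c j) = d y (c (a + r)) + d (c (a + r)) (c j)" for j using y(2)[of j] r(2) by simp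
    show False by (rule *[OF y(1) yr x ca]) (use False r(1) in auto)
  qed
qed

lemma extremal_common_gate:
  defines "C \<equiv> c ` {..<2 * k}"
  shows "\<exists>a\<in>C. \<forall>x\<in>V - C. (\<forall>v\<in>C. d x v = d x a + d a v) \<and> excess x a = 0"
proof (cases "V - C = {}")
  case True
  have "c 0 \<in> C" using k_ge_2 by (auto simp: C_def)
  then show ?thesis unfolding True by blast
next
  case False
  then obtain y where y: "y \<in> V - C" by blast
  then obtain b where b: "\<forall>j. d y (c j) = d y (c b) + d (c b) (c j)"
    using extremal_gate[of y] by blast
  have gate: "(\<forall>j. d x (c j) = d x (c b) + d (c b) (c j)) \<and> excess x (c b) = 0" if x: "x \<in> V - C" for x
  proof -
    obtain l where l: "\<forall>j. d x (c j) = d x (c l) + d (c l) (c j)" "excess x (c l) = 0"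
      using x extremal_gate[of x] by blast
    have eq: "c l = c b"
      by (rule extremal_gate_unique[OF x[unfolded C_def] l(1)[rule_format] y[unfolded C_def] b[rule_format]])
    show ?thesis using l unfolding eq by blast
  qed
  obtain r where "r < 2 * k" "c b = c (0 + r)" by (rule cycle_index)
  then have "c b \<in> C" by (auto simp: C_def)
  moreover have "(\<forall>v\<in>C. d x v = d x (c b) + d (c b) v) \<and> excess x (c b) = 0" if "x \<in> V - C" for x
    using gate[OF that] unfolding C_def by blast
  ultimately show ?thesis by blast
qed

text \<open>The tree consists of the common gate \<open>a\<close> and everything off the cycle. As
  the cycle has no chords and every edge from outside enters it at \<open>a\<close>, the edges not
  on the cycle stay within this set.\<close>

lemma extremal_structure: "cycle_tree_sharing_vertex (2 * k) (card V - 2 * k + 1) V E"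
proof -
  define C where "C = c ` {..<2 * k}"
  define F where "F = path_edges c (2 * k)"
  have C: "C \<subseteq> V" "card C = 2 * k" using cycle_in_V card_cycle by (auto simp: C_def)
  then have fin: "finite C" using finite_V finite_subset by blast
  obtain a where a: "a \<in> C" "\<And>x v. x \<in> V - C \<Longrightarrow> v \<in> C \<Longrightarrow> d x v = d x a + d a v"
    "\<And>x. x \<in> V - C \<Longrightarrow> excess x a = 0"
    using extremal_common_gate[folded C_def] by blast
  have aV: "a \<in> V" using a C by blast
  define T where "T = insert a (V - C)"
  define ET where "ET = E - F"
  have TV: "T \<subseteq> V" using aV by (auto simp: T_def)
  have FE: "F \<subseteq> E" using cycle_edge by (auto simp: F_def path_edges_def)
  have FC: "e \<subseteq> C" if "e \<in> F" for e
  proof -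
    have "c (Suc i) \<in> C" for i
    proof -
      obtain j where "j < 2 * k" "c (Suc i) = c (0 + j)" by (rule cycle_index)
      then show ?thesis by (auto simp: C_def)
    qed
    then show ?thesis using that by (auto simp: F_def path_edges_def C_def)
  qed
  have gate: "v = a" if "{x, v} \<in> E" "x \<in> V - C" "v \<in> C" for x v
  proof -
    have "d x a \<noteq> 0" using dist_eq_0[of x a] that aV a(1) by auto
    moreover have "d x v = 1" using that(1) by (rule dist_edge_1)
    ultimately have "d a v = 0" using a(2)[of x v] that by simp
    then show ?thesis using dist_eq_0 aV C(1) that by blast
  qed
  have ET: "{u, v} \<in> ET" if "{u, v} \<in> E" "u \<in> T" "v \<in> T" for u v
    using that FC[of "{u, v}"] edge_neq[of u v] by (auto simp: ET_def T_def)
  have ET_T: "e \<subseteq> T" if e: "e \<in> ET" for e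
  proof -
    have "e \<in> E" "e \<notin> F" using e by (auto simp: ET_def)
    then obtain u v where uv: "e = {u, v}" "{u, v} \<in> E" using edgeE by metis
    have "u \<notin> C \<or> v \<notin> C"
      using cycle_edges_induced[of u v] \<open>e \<notin> F\<close> uv by (auto simp: C_def F_def)
    moreover have "{v, u} \<in> E" using uv by (simp add: insert_commute)
    ultimately show ?thesis using uv gate[of u v] gate[of v u] edge_in_V[of u v] by (auto simp: T_def)
  qed
  have walk: "\<exists>p. walk_betw T ET u p v" if uT: "u \<in> T" and vT: "v \<in> T" for u v
    using vT
  proof (induction "d u v" arbitrary: v rule: less_induct)
    case less
    show ?case
    proof (cases "u = v")
      case True
      then show ?thesis using less.prems by (intro exI[of _ "[v]"]) (simp add: walk_betw_def)
    next
      case False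
      then obtain w where w: "{w, v} \<in> E" "d u v = Suc (d u w)"
        using dist_pred[of u v] uT less.prems TV by (metis subsetD)
      \<comment> \<open>The geodesic stays in \<open>T\<close>: if \<open>v = a\<close>, a
        predecessor on the cycle would be at least as far from \<open>u\<close> as \<open>a\<close>;
        otherwise the only neighbour of \<open>v\<close> on the cycle is \<open>a\<close>.\<close>
      have "w \<in> T"
      proof (cases "v = a")
        case True
        then have "w \<notin> C" using a(2)[of u w] False uT w(2) by (auto simp: T_def)
        then show ?thesis using w edge_in_V by (auto simp: T_def)
      next
        case False
        then have "w \<in> C \<Longrightarrow> w = a"
          using gate[of v w] w less.prems by (auto simp: T_def insert_commute)
        then show ?thesis using w edge_in_V by (auto simp: T_def)
      qed
      then obtain p where p: "walk_betw T ET u p w" using less.hyps[of w] w by auto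
      have "{w, v} \<in> ET" using ET w \<open>w \<in> T\<close> less.prems by blast
      then have "walk_betw T ET u (p @ [v]) v" using p less.prems by (intro walk_betw_snoc)
      then show ?thesis by blast
    qed
  qed
  have "simple_graph T ET"
  proof
    show "finite T" using TV finite_V by (rule finite_subset)
    show "e \<subseteq> T" if "e \<in> ET" for e using that by (rule ET_T)
    show "card e = 2" if "e \<in> ET" for e using that edge_card by (simp add: ET_def)
  qed
  moreover have "connected_graph T ET"
    unfolding connected_graph_def using walk by (simp add: T_def)
  \<comment> \<open>A cycle would contain a vertex with two neighbours closer to \<open>a\<close>.
    It lies outside \<open>C\<close>, so its excess with \<open>a\<close> is zero, against
    \<open>excess_two_preds\<close>.\<close>
  moreover have "acyclic_graph T ET"
    unfolding acyclic_graph_def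
  proof (intro notI, elim exE conjE)
    fix V' E' assume *: "V' \<subseteq> T" "E' \<subseteq> ET" "cycle_graph V' E'"
    moreover from this have "V' \<subseteq> V" "E' \<subseteq> E" using TV by (auto simp: ET_def)
    ultimately obtain v where v: "v \<in> V'" "two_preds a v"
      using two_preds_if_cycle[of V' E' a] aV by metis
    then have "d a v \<noteq> 0" by (auto simp: two_preds_def)
    then have "v \<in> V - C" using v(1) *(1) dist_self[OF aV] by (auto simp: T_def)
    then show False using a(3)[of v] excess_two_preds[OF v(2)] excess_commute[of v a] by simp
  qed
  ultimately have tree: "tree_graph T ET" by (simp add: tree_graph_def)
  have card_T: "card T = card V - 2 * k + 1"
    using C fin a(1) finite_V by (simp add: T_def card_Diff_subset)
  have cyc: "cycle_graph C F" unfolding C_def F_def by (rule cycle_graph_isometric)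
  have CT: "V = C \<union> T" "E = F \<union> ET" "\<exists>x. C \<inter> T = {x}" "F \<inter> ET = {}"
    using C a(1) FE by (auto simp: T_def ET_def)
  show ?thesis
    unfolding cycle_tree_sharing_vertex_def
    by (rule exI[of _ C], rule exI[of _ F], rule exI[of _ T], rule exI[of _ ET])
      (rule conjI[OF cyc] conjI[OF C(2)] conjI[OF tree] conjI[OF card_T] conjI[OF CT(1)]
        conjI[OF CT(2)] conjI[OF CT(3)] CT(4))+
qed

end

text \<open>
  Antipodal vertices of the cycle lie on different sides of every edge of the cycle, hence no such
  edge separates both of them from the same vertex.
\<close>

lemma card_sep_edges_antipodal_le:
  defines "F \<equiv> path_edges c (2 * k)"
  shows "card (sep_edges x (c i) \<inter> F) + card (sep_edges x (c (i + k)) \<inter> F) \<le> 2 * k"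
proof -
  have "sep_edges x (c i) \<inter> F \<inter> (sep_edges x (c (i + k)) \<inter> F) = {}"
  proof (rule ccontr)
    assume "sep_edges x (c i) \<inter> F \<inter> (sep_edges x (c (i + k)) \<inter> F) \<noteq> {}"
    then obtain j where "{c j, c (Suc j)} \<in> sep_edges x (c i)" "{c j, c (Suc j)} \<in> sep_edges x (c (i + k))"
      by (auto simp: F_def path_edges_def)
    then show False
      using cycle_antipodal_sum[of j i] cycle_antipodal_sum[of "Suc j" i]
      by (auto simp: sep_edges_iff graph_dist_commute[of V E "c j"] graph_dist_commute[of V E "c (Suc j)"])
  qed
  moreover have "finite F" by (simp add: F_def path_edges_def)
  ultimately have "card (sep_edges x (c i) \<inter> F) + card (sep_edges x (c (i + k)) \<inter> F) =
      card (sep_edges x (c i) \<inter> F \<union> sep_edges x (c (i + k)) \<inter> F)"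
    by (intro card_Un_disjoint[symmetric]) auto
  also have "\<dots> \<le> card F" using \<open>finite F\<close> by (intro card_mono) auto
  also have "\<dots> \<le> 2 * k" using card_image_le[of "{..<2 * k}"] by (simp add: F_def path_edges_def)
  finally show ?thesis .
qed

end

section \<open>A cycle and a tree sharing a vertex\<close>

text \<open>The colour classes restrict to the subgraph. This makes the whole theory of distances
  and separating edges available inside the tree.\<close>

lemma bip_subgraph:
  assumes "simple_graph V' E'" "connected_graph V' E'" "E' \<subseteq> E"
  shows "bip_graph V' E'"
proof -
  interpret G: simple_graph V' E' by fact
  have "\<exists>A. \<forall>u v. {u, v} \<in> E \<longrightarrow> (u \<in> A \<longleftrightarrow> v \<notin> A)"
    by (rule dist_parity) blast
  then obtain A where A: "\<And>u v. {u, v} \<in> E \<Longrightarrow> u \<in> A \<longleftrightarrow> v \<notin> A" by blast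
  have "\<exists>a\<in>V' \<inter> A. \<exists>b\<in>V' - A. e = {a, b}" if e: "e \<in> E'" for e
  proof -
    obtain u v where uv: "e = {u, v}" "{u, v} \<in> E" using e assms(3) edgeE by (metis subsetD)
    have V: "u \<in> V'" "v \<in> V'" using G.edge_subset[OF e] uv(1) by auto
    show ?thesis
    proof (cases "u \<in> A")
      case True
      then show ?thesis using A[OF uv(2)] V uv(1) by blast
    next
      case False
      moreover have "e = {v, u}" using uv(1) by (simp add: insert_commute)
      ultimately show ?thesis using A[OF uv(2)] V by blast
    qed
  qed
  then have "bipartite_graph V' E'"
    unfolding bipartite_graph_def by (intro exI[of _ "V' \<inter> A"] exI[of _ "V' - A"]) auto
  then show ?thesis using assms by (simp add: bip_graph_def bip_graph_axioms_def)
qed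

section \<open>Separating edges in a tree\<close>

lemma not_two_preds_if_acyclic:
  assumes "acyclic_graph V E"
  shows "\<not> two_preds u v"
proof
  assume "two_preds u v"
  then obtain k c where kc: "isometric_cycle k c" by (rule isometric_cycle_exists)
  moreover have "c ` {..<2 * k} \<subseteq> V" using cycle_in_V[OF kc] by blast
  moreover have "path_edges c (2 * k) \<subseteq> E" using cycle_edge[OF kc] by (auto simp: path_edges_def)
  ultimately show False
    using assms cycle_graph_isometric[OF kc] unfolding acyclic_graph_def by blast
qed

text \<open>Moving the end from \<open>y'\<close> to \<open>y\<close> creates at most the separating
  edge \<open>{y', y}\<close>. For any other new edge \<open>{u, v}\<close>, the vertex
  \<open>v\<close> and a predecessor of \<open>u\<close> towards \<open>y'\<close> would be two
  neighbours of \<open>u\<close> closer to \<open>y\<close>.\<close>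

lemma card_sep_edges_acyclic:
  assumes acyclic: "acyclic_graph V E" and V: "x \<in> V" "y \<in> V"
  shows "card (sep_edges x y) \<le> d x y"
  using V(2)
proof (induction "d x y" arbitrary: y)
  case 0
  then have "x = y" using V dist_eq_0 by simp
  then have "sep_edges x y = {}" by (auto simp: sep_edges_def)
  then show ?case by simp
next
  case (Suc n)
  then have "x \<noteq> y" using dist_self by force
  then obtain y' where y': "{y', y} \<in> E" "d x y = Suc (d x y')"
    using dist_pred V(1) Suc.prems by metis
  have y'V: "y' \<in> V" using y' edge_in_V by blast
  have "sep_edges x y \<subseteq> insert {y', y} (sep_edges x y')"
  proof
    fix e assume "e \<in> sep_edges x y"
    then obtain u v where e: "e = {u, v}" "{u, v} \<in> E" "d x u < d x v" "d y v < d y u"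
      by (auto simp: sep_edges_def)
    have uv: "u \<in> V" "v \<in> V" using e edge_in_V by auto
    show "e \<in> insert {y', y} (sep_edges x y')"
    proof (cases "d y' v < d y' u")
      case True
      then show ?thesis using e sep_edgesI by blast
    next
      case False
      have step: "d w y = Suc (d w y') \<or> d w y' = Suc (d w y)" if "w \<in> V" for w
        using dist_edge[OF that y'(1)] by auto
      have "d y u = Suc (d y v)" "d y' v = Suc (d y' u)"
        using dist_edge[OF Suc.prems e(2)] dist_edge[OF y'V e(2)] e(4) False by linarith+
      then have eq: "d y u = Suc (d y' u)" "d y' v = Suc (d y v)" "d y v = d y' u"
        using step[OF uv(1)] step[OF uv(2)]
        unfolding graph_dist_commute[of V E u] graph_dist_commute[of V E v] by linarith+
      show ?thesis
      proof (cases "u = y'")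
        case True
        then have "v = y" using eq(3) dist_self[OF y'V] dist_eq_0 Suc.prems uv by auto
        then show ?thesis using True e by simp
      next
        case False
        then obtain w where w: "{w, u} \<in> E" "d y' u = Suc (d y' w)"
          using dist_pred[OF y'V uv(1)] by metis
        then have wV: "w \<in> V" using edge_in_V by blast
        have "w \<noteq> v" using w eq by auto
        moreover have "d y w < d y u"
          using step[OF wV] w(2) eq unfolding graph_dist_commute[of V E w] by linarith
        moreover have "{v, u} \<in> E" using e(2) by (simp add: insert_commute)
        ultimately have "two_preds y u"
          unfolding two_preds_def using Suc.prems uv(1) w(1) e(4) by blast
        then show ?thesis using not_two_preds_if_acyclic[OF acyclic] by blast
      qed
    qed
  qed
  then have "card (sep_edges x y) \<le> card (insert {y', y} (sep_edges x y'))"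
    by (intro card_mono) (auto simp: finite_sep_edges)
  also have "\<dots> \<le> Suc (card (sep_edges x y'))" by (rule card_insert_le_m1[THEN order_trans]) auto
  also have "\<dots> \<le> Suc (d x y')" using Suc y'V y' by simp
  finally show ?case using y' by simp
qed

section \<open>Upper bounds on the excess when a tree is glued to an isometric cycle\<close>

context
  fixes k :: nat and c :: "nat \<Rightarrow> 'a" and C F T F\<^sub>T a
  defines "C \<equiv> c ` {..<2 * k}" and "F \<equiv> path_edges c (2 * k)"
  assumes cycle: "isometric_cycle k c"
    and tree: "tree_graph T F\<^sub>T"
    and glue: "V = C \<union> T" "C \<inter> T = {a}" "E = F \<union> F\<^sub>T"
begin

lemma glued_edge_cases:
  assumes "{u, v} \<in> E"
  shows "u \<in> T \<and> v \<in> T \<and> {u, v} \<in> F\<^sub>T \<or> u \<in> C \<and> v \<in> C \<and> {u, v} \<in> F"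
proof -
  interpret T: simple_graph T F\<^sub>T using tree by (simp add: tree_graph_def)
  have "c (Suc i) \<in> C" for i
    using cycle_index[OF cycle, of "Suc i" 0] by (auto simp: C_def)
  then have "e \<subseteq> C" if "e \<in> F" for e using that by (auto simp: F_def path_edges_def C_def)
  then show ?thesis using assms T.edge_subset[of "{u, v}"] glue(3) by blast
qed

text \<open>Followed backwards from \<open>v\<close>, a geodesic from \<open>x\<close> uses cycle
  edges until it meets \<open>a\<close>, since a vertex of the cycle other than \<open>a\<close> has
  no neighbour outside.\<close>

lemma glued_gate:
  assumes x: "x \<in> T" and v: "v \<in> C"
  shows "d x v = d x a + d a v"
proof (rule antisym)
  have V: "x \<in> V" "v \<in> V" "a \<in> V" using x v glue by auto
  then show "d x v \<le> d x a + d a v" by (intro dist_triangle)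
  show "d x a + d a v \<le> d x v"
    using v V(2)
  proof (induction "d x v" arbitrary: v rule: less_induct)
    case less
    show ?case
    proof (cases "v = a")
      case True
      then show ?thesis using V by (simp add: dist_self)
    next
      case False
      then have "v \<notin> T" using less.prems glue(2) by auto
      then obtain w where w: "{w, v} \<in> E" "d x v = Suc (d x w)"
        using dist_pred[OF V(1), of v] less.prems x by metis
      then have "w \<in> C" "w \<in> V" using glued_edge_cases \<open>v \<notin> T\<close> edge_in_V by blast+
      then have "d x a + d a w \<le> d x w" using less.hyps w by simp
      then show ?thesis using dist_edge_le[OF V(3) w(1)] w(2) by simp
    qed
  qed
qed

text \<open>Geodesics between tree vertices use tree edges only: a step from the cycle back into
  \<open>T\<close> would end in \<open>a\<close>, which by \<open>glued_gate\<close> is no farther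
  from \<open>x\<close> than the vertex before it.\<close>

lemma glued_tree_dist:
  assumes x: "x \<in> T" and y: "y \<in> T"
  shows "graph_dist T F\<^sub>T x y = d x y"
proof -
  interpret T: bip_graph T F\<^sub>T
    using tree glue(3) by (intro bip_subgraph) (auto simp: tree_graph_def)
  have TV: "T \<subseteq> V" using glue(1) by blast
  show ?thesis
  proof (rule T.dist_unique[OF x _ _ _ y])
    show "d x x = 0" using x TV by (auto simp: dist_self)
    show "d x w \<le> Suc (d x v)" if "{v, w} \<in> F\<^sub>T" for v w
      using that glue(3) x TV by (intro dist_edge_le) auto
    show "\<exists>w. {w, v} \<in> F\<^sub>T \<and> d x v = Suc (d x w)" if v: "v \<in> T" "v \<noteq> x" for v
    proof -
      obtain w where w: "{w, v} \<in> E" "d x v = Suc (d x w)"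
        using dist_pred[of x v] v x TV by auto
      have "{w, v} \<in> F\<^sub>T"
      proof (rule ccontr)
        assume "{w, v} \<notin> F\<^sub>T"
        then have "w \<in> C" "v \<in> C" using glued_edge_cases[OF w(1)] by auto
        moreover from this have "v = a" using v glue(2) by auto
        ultimately show False using glued_gate[OF x, of w] w(2) by simp
      qed
      then show ?thesis using w by blast
    qed
  qed
qed

lemma glued_sep_edges_tree:
  assumes x: "x \<in> T" and y: "y \<in> T"
  shows "card (sep_edges x y \<inter> F\<^sub>T) \<le> d x y"
proof -
  interpret T: bip_graph T F\<^sub>T
    using tree glue(3) by (intro bip_subgraph) (auto simp: tree_graph_def)
  have "sep_edges x y \<inter> F\<^sub>T \<subseteq> T.sep_edges x y"
  proof
    fix e assume e: "e \<in> sep_edges x y \<inter> F\<^sub>T"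
    then obtain u v where uv: "e = {u, v}" "d x u < d x v" "d y v < d y u"
      by (auto simp: sep_edges_def)
    moreover have "u \<in> T" "v \<in> T" using e uv(1) T.edge_in_V by auto
    ultimately show "e \<in> T.sep_edges x y"
      using e x y by (auto intro: T.sep_edgesI simp: glued_tree_dist)
  qed
  then have "card (sep_edges x y \<inter> F\<^sub>T) \<le> card (T.sep_edges x y)"
    by (intro card_mono T.finite_sep_edges)
  also have "\<dots> \<le> d x y"
    using T.card_sep_edges_acyclic[of x y] tree x y by (simp add: tree_graph_def glued_tree_dist)
  finally show ?thesis .
qed

text \<open>Both \<open>x\<close> and \<open>y\<close> see the cycle through \<open>a\<close>, hence
  agree on which end of a cycle edge is nearer. Only tree edges can separate them.\<close>

lemma glued_excess_tree:
  assumes x: "x \<in> T" and y: "y \<in> T"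
  shows "excess x y \<le> 0"
proof -
  have "sep_edges x y \<subseteq> F\<^sub>T"
  proof
    fix e assume e: "e \<in> sep_edges x y"
    then obtain u v where uv: "e = {u, v}" "{u, v} \<in> E" "d x u < d x v" "d y v < d y u"
      by (auto simp: sep_edges_def)
    then have "\<not> (u \<in> C \<and> v \<in> C)"
      using glued_gate[OF x, of u] glued_gate[OF x, of v] glued_gate[OF y, of u] glued_gate[OF y, of v]
      by auto
    then show "e \<in> F\<^sub>T" using glued_edge_cases uv by blast
  qed
  then have "sep_edges x y \<inter> F\<^sub>T = sep_edges x y" by blast
  then show ?thesis using glued_sep_edges_tree[OF x y] by (simp add: excess_def)
qed

text \<open>With \<open>h\<close> the distance from \<open>x\<close> to the cycle, at most
  \<open>h\<close> tree edges separate \<open>x\<close> from each antipode, and at most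
  \<open>2 * k\<close> cycle edges count in total. The two distances sum up to exactly
  \<open>2 * h + k\<close>, which leaves \<open>k\<close>.\<close>

lemma glued_excess_antipodal:
  assumes x: "x \<in> V"
  shows "excess x (c i) + excess x (c (i + k)) \<le> int k"
proof -
  have cC: "c j \<in> C" for j using cycle_index[OF cycle, of j 0] by (auto simp: C_def)
  have a: "a \<in> T" "a \<in> C" using glue(2) by auto
  \<comment> \<open>A vertex outside \<open>T\<close> lies on the cycle, hence the default 0; at
    \<open>a\<close> itself the first branch gives 0 too.\<close>
  define h where "h = (if x \<in> T then d x a else 0)"
  have gate: "d w u = d a u + d a w" if "u \<in> T" "w \<in> C" for u w
    using glued_gate[OF that] by (simp add: graph_dist_commute)
  have tree_part: "card (sep_edges x w \<inter> F\<^sub>T) \<le> h" if w: "w \<in> C" for w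
  proof -
    have uv: "u \<in> T \<and> v \<in> T" if "{u, v} \<in> F\<^sub>T" for u v
    proof -
      interpret T: simple_graph T F\<^sub>T using tree by (simp add: tree_graph_def)
      show ?thesis using T.edge_subset[OF that] by simp
    qed
    show ?thesis
    proof (cases "x \<in> T")
      case True
      have "sep_edges x w \<inter> F\<^sub>T \<subseteq> sep_edges x a \<inter> F\<^sub>T"
      proof
        fix e assume e: "e \<in> sep_edges x w \<inter> F\<^sub>T"
        then obtain u v where "e = {u, v}" "{u, v} \<in> E" "d x u < d x v" "d w v < d w u"
          by (auto simp: sep_edges_def)
        then show "e \<in> sep_edges x a \<inter> F\<^sub>T"
          using e uv[of u v] gate[OF _ w, of u] gate[OF _ w, of v] sep_edgesI[of u v x a] by auto
      qed
      then have "card (sep_edges x w \<inter> F\<^sub>T) \<le> card (sep_edges x a \<inter> F\<^sub>T)"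
        by (intro card_mono) (auto simp: finite_sep_edges)
      then show ?thesis using glued_sep_edges_tree[OF True a(1)] True by (simp add: h_def)
    next
      case False
      then have "x \<in> C" using x glue(1) by blast
      have "e \<notin> F\<^sub>T" if e: "e \<in> sep_edges x w" for e
      proof
        assume "e \<in> F\<^sub>T"
        obtain u v where "e = {u, v}" "d x u < d x v" "d w v < d w u"
          using e by (auto simp: sep_edges_def)
        then show False
          using \<open>e \<in> F\<^sub>T\<close> uv[of u v] gate[OF _ w, of u] gate[OF _ w, of v]
            gate[OF _ \<open>x \<in> C\<close>, of u] gate[OF _ \<open>x \<in> C\<close>, of v] by auto
      qed
      then have "sep_edges x w \<inter> F\<^sub>T = {}" by blast
      then show ?thesis by simp
    qed
  qed
  have "card (sep_edges x w) \<le> h + card (sep_edges x w \<inter> F)" if w: "w \<in> C" for w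
  proof -
    have "sep_edges x w = sep_edges x w \<inter> F\<^sub>T \<union> sep_edges x w \<inter> F"
      using sep_edges_subset[of x w] glue(3) by blast
    then have "card (sep_edges x w) \<le> card (sep_edges x w \<inter> F\<^sub>T) + card (sep_edges x w \<inter> F)"
      by (metis card_Un_le)
    then show ?thesis using tree_part[OF w] by simp
  qed
  note this[OF cC[of i]] this[OF cC[of "i + k"]]
  moreover have "card (sep_edges x (c i) \<inter> F) + card (sep_edges x (c (i + k)) \<inter> F) \<le> 2 * k"
    unfolding F_def by (rule card_sep_edges_antipodal_le[OF cycle])
  moreover have "d x (c i) + d x (c (i + k)) = 2 * h + k"
  proof (cases "x \<in> T")
    case True
    obtain j where "a = c j" using a(2) by (auto simp: C_def)
    then show ?thesis
      using cycle_antipodal_sum[OF cycle, of j i] glued_gate[OF True cC[of i]]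
        glued_gate[OF True cC[of "i + k"]] True
      by (simp add: h_def)
  next
    case False
    then obtain j where "x = c j" using x glue(1) by (auto simp: C_def)
    then show ?thesis using cycle_antipodal_sum[OF cycle, of j i] False by (simp add: h_def)
  qed
  ultimately show ?thesis by (simp add: excess_def)
qed

lemma glued_total_excess:
  "(\<Sum>x\<in>V. \<Sum>y\<in>V. excess x y) \<le> 2 * int k ^ 2 * (int (card V) - int k)"
proof -
  have C: "C \<subseteq> V" "card C = 2 * k" using glue(1) card_cycle[OF cycle] by (auto simp: C_def)
  then have fin: "finite C" using finite_V finite_subset by blast
  have "card (V - C) = card V - 2 * k" using C fin by (simp add: card_Diff_subset)
  then have card_diff: "int (card (V - C)) = int (card V) - 2 * int k"
    using card_V_ge[OF cycle] by simp
  have "(\<Sum>y\<in>C. excess x y) \<le> int k ^ 2" if "x \<in> V" for x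
  proof -
    have "(\<Sum>i<k. excess x (c i) + excess x (c (i + k))) \<le> (\<Sum>i<k. int k)"
      by (rule sum_mono) (rule glued_excess_antipodal[OF that])
    then show ?thesis using sum_excess_cycle[OF cycle] by (simp add: C_def power2_eq_square)
  qed
  then have "(\<Sum>x\<in>A. \<Sum>y\<in>C. excess x y) \<le> (\<Sum>x\<in>A. int k ^ 2)" if "A \<subseteq> V" for A
    using that by (intro sum_mono) auto
  from this[of V] this[of "V - C"]
  have "(\<Sum>x\<in>V. \<Sum>y\<in>C. excess x y) \<le> int (card V) * int k ^ 2"
    "(\<Sum>x\<in>V - C. \<Sum>y\<in>C. excess x y) \<le> int (card (V - C)) * int k ^ 2" by simp_all
  note this(1) this(2)[unfolded card_diff]
  moreover have "(\<Sum>x\<in>V - C. \<Sum>y\<in>V - C. excess x y) \<le> 0"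
    using glue(1) by (intro sum_nonpos glued_excess_tree) auto
  moreover have "2 * int k ^ 2 * (int (card V) - int k) =
      int (card V) * int k ^ 2 + (int (card V) - 2 * int k) * int k ^ 2"
    by (simp add: algebra_simps)
  ultimately show ?thesis using total_excess_split[OF cycle] unfolding C_def by linarith
qed

end

text \<open>Opposite vertices are distinct and at distance at most 2, and distance 1 is excluded by
  \<open>dist_edge\<close>, as their common neighbour is already at distance 1.\<close>

lemma four_cycle_isometric:
  assumes "cycle_graph C F" "card C = 4" "C \<subseteq> V" "F \<subseteq> E"
  obtains c where "isometric_cycle 2 c" "C = c ` {..<2 * 2}" "F = path_edges c (2 * 2)"
proof -
  obtain l where l: "distinct l" "C = set l" "F = {{l ! i, l ! (Suc i mod length l)} | i. i < length l}"
    using assms(1) by (auto simp: cycle_graph_def)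
  have len: "length l = 4" using assms(2) l distinct_card by metis
  define c where "c = (\<lambda>i. l ! (i mod 4))"
  have F: "F = path_edges c (2 * 2)"
  proof -
    have "path_edges c (2 * 2) = (\<lambda>i. {l ! i, l ! (Suc i mod length l)}) ` {..<length l}"
      unfolding path_edges_def by (rule image_cong) (auto simp: c_def len)
    then show ?thesis unfolding l(3) by blast
  qed
  have edge: "{c i, c (Suc i)} \<in> E" for i
  proof -
    have "{l ! (i mod 4), l ! (Suc (i mod 4) mod length l)} \<in> F"
      unfolding l(3) using len by (intro CollectI exI[of _ "i mod 4"]) simp
    then show ?thesis using assms(4) len by (auto simp: c_def mod_Suc_eq)
  qed
  have "d (c i) (c (i + 2)) = 2" for i
  proof -
    have V: "c j \<in> V" for j using edge edge_in_V by blast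
    have le: "d (c i) (c (i + 2)) \<le> 2" by (rule dist_chain) (rule edge)
    have "i mod 4 \<noteq> (i + 2) mod 4" by presburger
    then have "c i \<noteq> c (i + 2)" using l(1) len by (simp add: c_def nth_eq_iff_index_eq)
    then have "d (c i) (c (i + 2)) \<noteq> 0" using V dist_eq_0 by blast
    moreover have "d (c i) (c (i + 2)) \<noteq> d (c i) (c (Suc i))"
      using dist_edge[OF V[of i] edge[of "Suc i"]] by auto
    moreover have "d (c i) (c (Suc i)) = 1" using edge by (rule dist_edge_1)
    ultimately show ?thesis using le by linarith
  qed
  then have "isometric_cycle 2 c" using edge by (simp add: isometric_cycle_def c_def)
  moreover have "C = c ` {..<2 * 2}"
    unfolding l(2) using len by (force simp: c_def in_set_conv_nth image_iff)
  ultimately show thesis using that F by blast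
qed

section \<open>The inequality and both directions of the equality case\<close>

theorem szeged_minus_wiener_ge:
  assumes "card V \<le> card E"
  shows "4 * int (card V) - 8 \<le> int (szeged_index V E) - int (wiener_index V E)"
    and "int (szeged_index V E) - int (wiener_index V E) = 4 * int (card V) - 8 \<longleftrightarrow>
      cycle_tree_sharing_vertex 4 (card V - 3) V E"
proof -
  obtain u v where "two_preds u v" using assms by (rule two_preds_if_many_edges)
  then obtain k c where kc: "isometric_cycle k c" by (rule isometric_cycle_exists)
  show ge: "4 * int (card V) - 8 \<le> int (szeged_index V E) - int (wiener_index V E)"
    using total_excess_ge_linear(1)[OF kc] unfolding szeged_minus_wiener[symmetric] by presburger
  show "int (szeged_index V E) - int (wiener_index V E) = 4 * int (card V) - 8 \<longleftrightarrow>
      cycle_tree_sharing_vertex 4 (card V - 3) V E"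
  proof
    assume "int (szeged_index V E) - int (wiener_index V E) = 4 * int (card V) - 8"
    then have eq: "(\<Sum>x\<in>V. \<Sum>y\<in>V. excess x y) = 8 * int (card V) - 16"
      unfolding szeged_minus_wiener[symmetric] by presburger
    then have k: "k = 2" using total_excess_ge_linear(2)[OF kc] by force
    have "cycle_tree_sharing_vertex (2 * k) (card V - 2 * k + 1) V E"
      by (rule extremal_structure[OF kc]) (simp add: eq k)
    \<comment> \<open>For truncated subtraction this needs \<open>card V\<close> to be at least 4,
      which the cycle guarantees.\<close>
    moreover have "card V - 2 * k + 1 = card V - 3" using card_V_ge[OF kc] k by simp
    ultimately show "cycle_tree_sharing_vertex 4 (card V - 3) V E" using k by simp
  next
    assume "cycle_tree_sharing_vertex 4 (card V - 3) V E"
    then obtain C F T F\<^sub>T a where *: "cycle_graph C F" "card C = 4" "tree_graph T F\<^sub>T"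
      "V = C \<union> T" "E = F \<union> F\<^sub>T" "C \<inter> T = {a}"
      by (auto simp: cycle_tree_sharing_vertex_def)
    then obtain c where c: "isometric_cycle 2 c" "C = c ` {..<2 * 2}" "F = path_edges c (2 * 2)"
      using four_cycle_isometric[of C F] by blast
    have "(\<Sum>x\<in>V. \<Sum>y\<in>V. excess x y) \<le> 2 * int 2 ^ 2 * (int (card V) - int 2)"
      by (rule glued_total_excess[OF c(1) *(3)]) (use * c in auto)
    then show "int (szeged_index V E) - int (wiener_index V E) = 4 * int (card V) - 8"
      using ge unfolding szeged_minus_wiener[symmetric] by simp
  qed
qed

end

theorem theorem2p3:
  fixes V :: "'a set" and E :: "'a set set" and n m :: nat
  assumes "simple_graph V E"
    and "connected_graph V E"
    and "bipartite_graph V E"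
    and "card V = n" and "n \<ge> 4"
    and "card E = m" and "m \<ge> n"
  shows "int (szeged_index V E) - int (wiener_index V E) \<ge> 4 * int n - 8 \<and>
    (int (szeged_index V E) - int (wiener_index V E) = 4 * int n - 8 \<longleftrightarrow>
      cycle_tree_sharing_vertex 4 (n - 3) V E)"
proof -
  interpret bip_graph V E
    using assms by (simp add: bip_graph_def bip_graph_axioms_def)
  show ?thesis using szeged_minus_wiener_ge assms(4-) by simp
qed

end
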